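(* Let $N$ be a finitary plain structural conflict net without a fully reachable pure $\mathsf M$. Then $N$ is distributable up to $\approx^\Delta_{bSTb}$, i.e. there exists a distributed Petri net $D$ with $D\approx^\Delta_{bSTb}N$.
   Context: Fix a set $\mathrm{Act}$ of visible actions and an invisible action $\tau\notin\mathrm{Act}$. A (labelled) Petri net is a tuple $N=(S,T,F,M_0,\ell)$ with $S,T$ disjoint sets of places and transitions, $F:(S\times T)\cup(T\times S)\to\mathbb N$, $M_0\in\mathbb N^S$ and $\ell:T\to\mathrm{Act}\cup\{\tau\}$. For $x\in S\cup T$, ${}^\bullet x(y)=F(y,x)$ and $x^\bullet(y)=F(x,y)$ (multisets), extended additively to finite multisets. Multiset $\le,\cap,\cup$ are pointwise $\le$, min, max. For a finite nonempty multiset $G$ of transitions, $M[G\rangle M'$ iff ${}^\bullet G\le M$ and $M'=M-{}^\bullet G+G^\bullet$; reachable markings are those obtained from $M_0$ by such steps. $t\smile u$ iff $M[\{t\}+\{u\}\rangle$ for some reachable $M$. Structural conflict net: $t\smile u\Rightarrow{}^\bullet t\cap{}^\bullet u=\emptyset$. Plain: $\ell$ injective, never $\tau$. Finitary: ${}^\bullet t\ne\emptyset$ for all $t$, and each reachable marking is finite and enables finitely many transitions. Fully reachable pure $\mathsf M$: transitions $t,u,v$ with ${}^\bullet t\cap{}^\bullet u\neq\emptyset$, ${}^\bullet u\cap{}^\bullet v\neq\emptyset$, ${}^\bullet t\cap{}^\bullet v=\emptyset$ and a reachable $M$ with ${}^\bullet t\cup{}^\bullet u\cup{}^\bullet v\le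 M$. A net is distributed iff there is a function $D$ on $S\cup T$ with (1) $s\in{}^\bullet t\Rightarrow D(t)=D(s)$ and (2) $t\smile u\Rightarrow D(t)\ne D(u)$. $\approx^\Delta_{bSTb}$ (branching ST-bisimilarity with explicit divergence): LTS notation $\Rightarrow$ = reflexive transitive closure of $\xrightarrow{\tau}$, $\mathfrak M\xrightarrow{(\alpha)}\mathfrak M'$ iff $\mathfrak M\xrightarrow{\alpha}\mathfrak M'$ or ($\alpha=\tau$, $\mathfrak M=\mathfrak M'$). A branching bisimulation with explicit divergence is $\mathcal B\subseteq\mathfrak S_1\times\mathfrak S_2$ relating the initial states such that whenever $\mathfrak M_1\mathcal B\mathfrak M_2$ and $\mathfrak M_1\xrightarrow{\alpha}\mathfrak M_1'$ there are $\mathfrak M_2\Rightarrow\mathfrak M_2^\dagger\xrightarrow{(\alpha)}\mathfrak M_2'$ with $\mathfrak M_1\mathcal B\mathfrak M_2^\dagger$, $\mathfrak M_1'\mathcal B\mathfrak M_2'$, and symmetrically; and whenever $\mathfrak M_1\mathcal B\mathfrak M_2$ and $\mathfrak M_1=\mathfrak M_1^0\xrightarrow{\tau}\mathfrak M_1^1\xrightarrow{\tau}\cdots$ infinitely with all $\mathfrak M_1^k\mathcal B\mathfrak M_2$, there is an infinite $\mathfrak M_2=\mathfrak M_2^0\xrightarrow{\tau}\mathfrak M_2^1\xrightarrow{\tau}\cdots$ with $\mathfrak M_1^k\mathcal B\mathfrak M_2^l$ for all $k,l$, and symmetrically. The ST-LTS of a net: states $(M,U)\in\mathbb N^S\times T^*$,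 initial $(M_0,\varepsilon)$; $(M,U)\xrightarrow{a^+}(M-{}^\bullet t,Ut)$ iff $\ell(t)=a\in\mathrm{Act}$ and $M[t\rangle$; $(M,U)\xrightarrow{a^{-n}}(M+t^\bullet,U^{-n})$ iff the $n$-th element $t$ of $U$ has $\ell(t)=a$ ($U^{-n}$: $U$ with $n$-th element removed); $(M,U)\xrightarrow{\tau}(M',U)$ iff $M[t\rangle M'$ with $\ell(t)=\tau$. Two nets are $\approx^\Delta_{bSTb}$ iff their ST-LTSs are related by such a $\mathcal B$. *)

theory Defs
  imports Main "HOL-Library.Multiset"
begin

text \<open>A labelled Petri net with places of type 's, transitions of type 't and
visible actions of type 'a.  The label None stands for the invisible action tau.
The carrier sets S and T are explicit (disjointness is guaranteed by the types).\<close>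

record ('s, 't, 'a) pnet =
  places :: "'s set"
  transs :: "'t set"
  Fpt    :: "'s \<Rightarrow> 't \<Rightarrow> nat"
  Ftp    :: "'t \<Rightarrow> 's \<Rightarrow> nat"
  M0     :: "'s \<Rightarrow> nat"
  lab    :: "'t \<Rightarrow> 'a option"

definition wf_net :: "('s, 't, 'a) pnet \<Rightarrow> bool" where
  "wf_net N \<longleftrightarrow>
     (\<forall>s t. Fpt N s t \<noteq> 0 \<longrightarrow> s \<in> places N \<and> t \<in> transs N) \<and>
     (\<forall>t s. Ftp N t s \<noteq> 0 \<longrightarrow> s \<in> places N \<and> t \<in> transs N) \<and>
     (\<forall>s. M0 N s \<noteq> 0 \<longrightarrow> s \<in> places N)"

definition preT :: "('s, 't, 'a) pnet \<Rightarrow> 't \<Rightarrow> 's \<Rightarrow> nat" where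
  "preT N t = (\<lambda>s. Fpt N s t)"

definition postT :: "('s, 't, 'a) pnet \<Rightarrow> 't \<Rightarrow> 's \<Rightarrow> nat" where
  "postT N t = Ftp N t"

definition preG :: "('s, 't, 'a) pnet \<Rightarrow> 't multiset \<Rightarrow> 's \<Rightarrow> nat" where
  "preG N G = (\<lambda>s. sum_mset (image_mset (\<lambda>t. Fpt N s t) G))"

definition postG :: "('s, 't, 'a) pnet \<Rightarrow> 't multiset \<Rightarrow> 's \<Rightarrow> nat" where
  "postG N G = (\<lambda>s. sum_mset (image_mset (\<lambda>t. Ftp N t s) G))"

definition fires :: "('s, 't, 'a) pnet \<Rightarrow> ('s \<Rightarrow> nat) \<Rightarrow> 't multiset \<Rightarrow> ('s \<Rightarrow> nat) \<Rightarrow> bool" where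
  "fires N M G M' \<longleftrightarrow> G \<noteq> {#} \<and> set_mset G \<subseteq> transs N \<and>
     (\<forall>s. preG N G s \<le> M s) \<and> M' = (\<lambda>s. M s - preG N G s + postG N G s)"

definition enabled :: "('s, 't, 'a) pnet \<Rightarrow> ('s \<Rightarrow> nat) \<Rightarrow> 't multiset \<Rightarrow> bool" where
  "enabled N M G \<longleftrightarrow> (\<exists>M'. fires N M G M')"

inductive reachable :: "('s, 't, 'a) pnet \<Rightarrow> ('s \<Rightarrow> nat) \<Rightarrow> bool" for N where
  init: "reachable N (M0 N)"
| step: "reachable N M \<Longrightarrow> fires N M G M' \<Longrightarrow> reachable N M'"

definition concurrent :: "('s, 't, 'a) pnet \<Rightarrow> 't \<Rightarrow> 't \<Rightarrow> bool" where
  "concurrent N t u \<longleftrightarrow> (\<exists>M. reachable N M \<and> enabled N M ({#t#} + {#u#}))"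

definition disjoint_pre :: "('s, 't, 'a) pnet \<Rightarrow> 't \<Rightarrow> 't \<Rightarrow> bool" where
  "disjoint_pre N t u \<longleftrightarrow> (\<forall>s. min (preT N t s) (preT N u s) = 0)"

definition structural_conflict_net :: "('s, 't, 'a) pnet \<Rightarrow> bool" where
  "structural_conflict_net N \<longleftrightarrow>
     (\<forall>t\<in>transs N. \<forall>u\<in>transs N. concurrent N t u \<longrightarrow> disjoint_pre N t u)"

definition plain :: "('s, 't, 'a) pnet \<Rightarrow> bool" where
  "plain N \<longleftrightarrow> inj_on (lab N) (transs N) \<and> (\<forall>t\<in>transs N. lab N t \<noteq> None)"

definition finitary :: "('s, 't, 'a) pnet \<Rightarrow> bool" where
  "finitary N \<longleftrightarrow>
     (\<forall>t\<in>transs N. \<exists>s. preT N t s \<noteq> 0) \<and>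
     (\<forall>M. reachable N M \<longrightarrow>
        finite {s. M s \<noteq> 0} \<and> finite {t\<in>transs N. enabled N M {#t#}})"

definition fully_reachable_pure_M :: "('s, 't, 'a) pnet \<Rightarrow> bool" where
  "fully_reachable_pure_M N \<longleftrightarrow>
     (\<exists>t\<in>transs N. \<exists>u\<in>transs N. \<exists>v\<in>transs N.
        \<not> disjoint_pre N t u \<and> \<not> disjoint_pre N u v \<and> disjoint_pre N t v \<and>
        (\<exists>M. reachable N M \<and>
           (\<forall>s. max (max (preT N t s) (preT N u s)) (preT N v s) \<le> M s)))"

text \<open>Distributed net.  The location function D is taken with values in S \<union> T
(encoded as the sum type); this is no loss of generality, since any function
into an arbitrary set of locations induces a partition and locations can be
replaced by representatives.\<close>
definition distributed :: "('s, 't, 'a) pnet \<Rightarrow> bool" where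
  "distributed N \<longleftrightarrow> (\<exists>D :: 's + 't \<Rightarrow> 's + 't.
     (\<forall>s\<in>places N. \<forall>t\<in>transs N. preT N t s \<noteq> 0 \<longrightarrow> D (Inr t) = D (Inl s)) \<and>
     (\<forall>t\<in>transs N. \<forall>u\<in>transs N. concurrent N t u \<longrightarrow> D (Inr t) \<noteq> D (Inr u)))"

datatype 'a stlab = Tau | Start 'a | Finish 'a nat

inductive st_step :: "('s, 't, 'a) pnet \<Rightarrow> ('s \<Rightarrow> nat) \<times> 't list \<Rightarrow> 'a stlab
                      \<Rightarrow> ('s \<Rightarrow> nat) \<times> 't list \<Rightarrow> bool" for N where
  start: "t \<in> transs N \<Longrightarrow> lab N t = Some a \<Longrightarrow> enabled N M {#t#} \<Longrightarrow>
          st_step N (M, U) (Start a) (\<lambda>s. M s - preT N t s, U @ [t])"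
| finish: "n < length U \<Longrightarrow> lab N (U ! n) = Some a \<Longrightarrow>
          st_step N (M, U) (Finish a n) (\<lambda>s. M s + postT N (U ! n) s, take n U @ drop (Suc n) U)"
| tau: "t \<in> transs N \<Longrightarrow> lab N t = None \<Longrightarrow> fires N M {#t#} M' \<Longrightarrow>
          st_step N (M, U) Tau (M', U)"

definition opt_step :: "('st \<Rightarrow> 'a stlab \<Rightarrow> 'st \<Rightarrow> bool) \<Rightarrow> 'st \<Rightarrow> 'a stlab \<Rightarrow> 'st \<Rightarrow> bool" where
  "opt_step step x \<alpha> x' \<longleftrightarrow> step x \<alpha> x' \<or> (\<alpha> = Tau \<and> x = x')"

definition bbd_half :: "('st1 \<Rightarrow> 'a stlab \<Rightarrow> 'st1 \<Rightarrow> bool) \<Rightarrow> ('st2 \<Rightarrow> 'a stlab \<Rightarrow> 'st2 \<Rightarrow> bool)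
                        \<Rightarrow> ('st1 \<Rightarrow> 'st2 \<Rightarrow> bool) \<Rightarrow> bool" where
  "bbd_half step1 step2 R \<longleftrightarrow>
     (\<forall>x y \<alpha> x'. R x y \<and> step1 x \<alpha> x' \<longrightarrow>
        (\<exists>y' y''. (\<lambda>a b. step2 a Tau b)\<^sup>*\<^sup>* y y' \<and> opt_step step2 y' \<alpha> y'' \<and> R x y' \<and> R x' y'')) \<and>
     (\<forall>x y f. R x y \<and> f 0 = x \<and> (\<forall>k. step1 (f k) Tau (f (Suc k)) \<and> R (f k) y) \<longrightarrow>
        (\<exists>g. g 0 = y \<and> (\<forall>l. step2 (g l) Tau (g (Suc l))) \<and> (\<forall>k l. R (f k) (g l))))"

definition bbd_bisim :: "('st1 \<Rightarrow> 'a stlab \<Rightarrow> 'st1 \<Rightarrow> bool) \<Rightarrow> ('st2 \<Rightarrow> 'a stlab \<Rightarrow> 'st2 \<Rightarrow> bool)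
                        \<Rightarrow> ('st1 \<Rightarrow> 'st2 \<Rightarrow> bool) \<Rightarrow> bool" where
  "bbd_bisim step1 step2 R \<longleftrightarrow> bbd_half step1 step2 R \<and> bbd_half step2 step1 R\<inverse>\<inverse>"

definition bSTb_div_equiv :: "('s1, 't1, 'a) pnet \<Rightarrow> ('s2, 't2, 'a) pnet \<Rightarrow> bool" where
  "bSTb_div_equiv N1 N2 \<longleftrightarrow> (\<exists>R. R (M0 N1, []) (M0 N2, []) \<and> bbd_bisim (st_step N1) (st_step N2) R)"

text \<open>Universe for the places and transitions of the distributed net: lists of
sets over places, transitions and natural-number tags of N.\<close>
type_synonym ('s, 't) univ = "('s + 't + nat) set list"

end

theory Submission
  imports Defs "HOL-Library.FSet" "HOL-Library.Countable_Set"
begin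

text \<open>Idea. Unfold \<open>N\<close> with individual tokens into events and conditions. Absence of a
fully reachable pure M makes direct conflict transitive on the events enabled in one
configuration, so these fall into cliques, each of which is one local choice.

In the distributed net every token on a condition \<open>b\<close> carries the configuration \<open>V\<close> of
finished events that it has heard of, and resides at the location named by \<open>V\<close> and the clique
competing for \<open>b\<close> at \<open>V\<close>. Finishing an event sends a message to all locations; reading it is a
silent step by which a token enlarges its \<open>V\<close> and moves on. An event may be fired at \<open>V\<close> once all
its preconditions carry \<open>V\<close>, hence reside at the same location. Concurrent cliques live at
different locations, and inside a location a control token excludes concurrency. All silent steps
only propagate knowledge, so they are inert and cannot go on forever. A location is blocked while
an event fires there, but by transitivity of conflict no condition waiting there is needed by an
event that is still executable.\<close>

subsection \<open>Unfolding\<close>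

text \<open>A condition is one individual token: its producer (\<open>None\<close> for an initial
  token), its place, and a number separating tokens that one producer puts on the same place. Names
  contain their whole causal history; \<open>fset\<close> keeps the recursion well founded.\<close>

datatype ('s, 't) ev = Ev (tr: 't) (fpre: "('s, 't) cond fset")
  and ('s, 't) cond = Cond "('s, 't) ev option" (place_of: 's) nat

definition pre :: "('s, 't) ev \<Rightarrow> ('s, 't) cond set" where
  "pre e = fset (fpre e)"

text \<open>The marking represented by a set of conditions. \<open>card\<close> is 0 on infinite
  sets, whence the finiteness assumptions below.\<close>

definition cnt :: "('s, 't) cond set \<Rightarrow> 's \<Rightarrow> nat" where
  "cnt B s = card {b \<in> B. place_of b = s}"

lemma finite_pre [simp]: "finite (pre e)"
  by (simp add: pre_def)

lemma cnt_Un_disjoint: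
  "finite A \<Longrightarrow> finite B \<Longrightarrow> A \<inter> B = {} \<Longrightarrow> cnt (A \<union> B) s = cnt A s + cnt B s"
  unfolding cnt_def by (subst card_Un_disjoint[symmetric]) (auto intro: arg_cong[where f=card])

lemma cnt_mono: "finite B \<Longrightarrow> A \<subseteq> B \<Longrightarrow> cnt A s \<le> cnt B s"
  unfolding cnt_def by (rule card_mono) auto

lemma cnt_Diff: "finite B \<Longrightarrow> A \<subseteq> B \<Longrightarrow> cnt (B - A) s = cnt B s - cnt A s"
  using cnt_Un_disjoint[of "B - A" A s] finite_subset[of A B]
  by (simp add: Un_absorb2 Int_commute)

lemma cnt_pos_iff: "finite B \<Longrightarrow> 0 < cnt B s \<longleftrightarrow> (\<exists>b\<in>B. place_of b = s)"
  unfolding cnt_def card_gt_0_iff by auto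

lemma fires_single:
  "fires N M {#t#} M' \<longleftrightarrow> t \<in> transs N \<and> (\<forall>s. Fpt N s t \<le> M s) \<and>
     M' = (\<lambda>s. M s - Fpt N s t + Ftp N t s)"
  by (simp add: fires_def preG_def postG_def)

lemma enabled_single:
  "enabled N M {#t#} \<longleftrightarrow> t \<in> transs N \<and> (\<forall>s. Fpt N s t \<le> M s)"
  by (simp add: enabled_def fires_single)

locale unfolding_net =
  fixes N :: "('s, 't, 'a) pnet"
  assumes fin: "finitary N"
    and scn: "structural_conflict_net N"
    and noM: "\<not> fully_reachable_pure_M N"
begin

definition init_conds :: "('s, 't) cond set" where
  "init_conds = {Cond None s i | s i. i < M0 N s}"

definition post :: "('s, 't) ev \<Rightarrow> ('s, 't) cond set" where
  "post e = {Cond (Some e) s i | s i. i < Ftp N (tr e) s}"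

definition cut :: "('s, 't) ev set \<Rightarrow> ('s, 't) cond set" where
  "cut V = (init_conds \<union> \<Union>(post ` V)) - \<Union>(pre ` V)"

text \<open>An event is a transition together with a choice of concrete tokens from the cut, as many
  on each place as the arc weight demands.\<close>

definition en :: "('s, 't) ev set \<Rightarrow> ('s, 't) ev set" where
  "en V = {e. tr e \<in> transs N \<and> (\<forall>s. cnt (pre e) s = Fpt N s (tr e)) \<and> pre e \<subseteq> cut V}"

inductive cfg :: "('s, 't) ev set \<Rightarrow> bool" where
  cfg_empty: "cfg {}"
| cfg_insert: "cfg V \<Longrightarrow> e \<in> en V \<Longrightarrow> cfg (insert e V)"

lemma cnt_init: "cnt init_conds s = M0 N s"
proof -
  have "{b \<in> init_conds. place_of b = s} = Cond None s ` {..<M0 N s}"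
    by (auto simp: init_conds_def)
  then show ?thesis
    by (simp add: cnt_def card_image inj_on_def)
qed

lemma cnt_post: "cnt (post e) s = Ftp N (tr e) s"
proof -
  have "{b \<in> post e. place_of b = s} = Cond (Some e) s ` {..<Ftp N (tr e) s}"
    by (auto simp: post_def)
  then show ?thesis
    by (simp add: cnt_def card_image inj_on_def)
qed

lemma finite_init: "finite init_conds"
proof -
  have "finite {s. M0 N s \<noteq> 0}"
    using fin reachable.init[of N] by (auto simp: finitary_def)
  then have "finite (\<Union>s\<in>{s. M0 N s \<noteq> 0}. Cond (None :: ('s, 't) ev option) s ` {..<M0 N s})"
    by blast
  then show ?thesis
    by (rule rev_finite_subset) (force simp: init_conds_def)
qed

lemma pre_nonempty: "e \<in> en V \<Longrightarrow> pre e \<noteq> {}"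
proof
  assume e: "e \<in> en V" and "pre e = {}"
  then have "\<forall>s. Fpt N s (tr e) = 0"
    by (auto simp: en_def cnt_def)
  then show False
    using e fin by (auto simp: finitary_def en_def preT_def)
qed

text \<open>An event of \<open>V\<close> has already consumed its preconditions, and finitarity
  provides at least one.\<close>

lemma en_notin: "e \<in> en V \<Longrightarrow> e \<notin> V"
  using pre_nonempty by (fastforce simp: en_def cut_def)

lemma en_cut: "e \<in> en V \<Longrightarrow> pre e \<subseteq> cut V"
  by (simp add: en_def)

lemma post_notin_cut: "e \<notin> V \<Longrightarrow> post e \<inter> cut V = {}"
  by (auto simp: cut_def post_def init_conds_def)

lemma cfg_closed: "cfg V \<Longrightarrow> e \<in> V \<Longrightarrow> pre e \<subseteq> init_conds \<union> \<Union>(post ` V)"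
  by (induction rule: cfg.induct) (auto simp: en_def cut_def)

lemma cfg_disjoint: "cfg V \<Longrightarrow> e \<in> V \<Longrightarrow> f \<in> V \<Longrightarrow> e \<noteq> f \<Longrightarrow> pre e \<inter> pre f = {}"
proof (induction rule: cfg.induct)
  case (cfg_insert V d)
  then show ?case by (auto simp: en_def cut_def)
qed simp

text \<open>An event does not consume its own products, because those need the event in the
configuration while it is only enabled outside of it.\<close>
lemma cut_insert:
  assumes "cfg V" "e \<in> en V"
  shows "cut (insert e V) = cut V - pre e \<union> post e"
proof -
  have "e \<notin> V" using assms en_notin by blast
  then have "post e \<inter> \<Union>(pre ` V) = {}"
    using cfg_closed[OF assms(1)] by (fastforce simp: post_def init_conds_def)
  moreover have "post e \<inter> pre e = {}"
    using assms post_notin_cut[OF \<open>e \<notin> V\<close>] by (auto simp: en_def)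
  ultimately show ?thesis
    by (auto simp: cut_def)
qed

lemma cfg_finite: "cfg V \<Longrightarrow> finite V"
  by (induction rule: cfg.induct) auto

text \<open>Adding an event is firing its transition. Both claims go in one induction: counting
  needs a finite cut, and the next cut is finite because the next marking is reachable.\<close>

lemma cfg_reachable: "cfg V \<Longrightarrow> finite (cut V) \<and> reachable N (cnt (cut V))"
proof (induction rule: cfg.induct)
  case cfg_empty
  have "cnt (cut {}) = M0 N"
    by (auto simp: cut_def cnt_init)
  then show ?case
    using finite_init reachable.init[of N] by (simp add: cut_def)
next
  case (cfg_insert V e)
  let ?M = "cnt (cut V)"
  have e: "tr e \<in> transs N" "\<And>s. cnt (pre e) s = Fpt N s (tr e)" "pre e \<subseteq> cut V"
    using cfg_insert by (auto simp: en_def)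
  have le: "Fpt N s (tr e) \<le> ?M s" for s
    using cnt_mono[of "cut V" "pre e" s] cfg_insert.IH e by simp
  have "fires N ?M {#tr e#} (\<lambda>s. ?M s - Fpt N s (tr e) + Ftp N (tr e) s)"
    using e le by (simp add: fires_single)
  then have r: "reachable N (\<lambda>s. ?M s - Fpt N s (tr e) + Ftp N (tr e) s)"
    using cfg_insert.IH reachable.step by blast
  then have "finite {s. ?M s - Fpt N s (tr e) + Ftp N (tr e) s \<noteq> 0}"
    using fin unfolding finitary_def by blast
  \<comment> \<open>The products lie below the successor marking, whose support is finite by
    finitarity.\<close>
  then have "finite {s. Ftp N (tr e) s \<noteq> 0}"
    by (rule rev_finite_subset) auto
  then have "finite (\<Union>s\<in>{s. Ftp N (tr e) s \<noteq> 0}. Cond (Some e) s ` {..<Ftp N (tr e) s})"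
    by blast
  then have fp: "finite (post e)"
    by (rule rev_finite_subset) (force simp: post_def)
  have "cnt (cut (insert e V)) = (\<lambda>s. ?M s - Fpt N s (tr e) + Ftp N (tr e) s)"
  proof
    fix s
    show "cnt (cut (insert e V)) s = ?M s - Fpt N s (tr e) + Ftp N (tr e) s"
    using cnt_Un_disjoint[of "cut V - pre e" "post e" s] cnt_Diff[of "cut V" "pre e" s]
      post_notin_cut[OF en_notin[OF cfg_insert.hyps(2)]] cfg_insert.IH fp e
      cut_insert[OF cfg_insert.hyps]
    by (auto simp: cnt_post)
  qed
  then show ?case
    using r fp cfg_insert.IH cut_insert[OF cfg_insert.hyps] by simp
qed

lemmas finite_cut = cfg_reachable[THEN conjunct1]
lemmas reachable_cut = cfg_reachable[THEN conjunct2]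

lemma finite_post: "cfg V \<Longrightarrow> e \<in> en V \<Longrightarrow> finite (post e)"
  using finite_cut[OF cfg_insert] cut_insert by (metis finite_Un)

lemma en_le: "cfg V \<Longrightarrow> e \<in> en V \<Longrightarrow> Fpt N s (tr e) \<le> cnt (cut V) s"
  using cnt_mono[of "cut V" "pre e" s] finite_cut by (auto simp: en_def)

section \<open>Conflict between events enabled at one configuration\<close>

lemma en_share:
  assumes "cfg V" "e \<in> en V" "f \<in> en V" "pre e \<inter> pre f \<noteq> {}"
  shows "\<not> disjoint_pre N (tr e) (tr f)"
proof -
  obtain b where b: "b \<in> pre e" "b \<in> pre f" using assms by blast
  then have "0 < cnt (pre e) (place_of b)" "0 < cnt (pre f) (place_of b)"
    by (auto simp: cnt_pos_iff)
  then have "0 < Fpt N (place_of b) (tr e)" "0 < Fpt N (place_of b) (tr f)"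
    using assms by (auto simp: en_def)
  then show ?thesis
    by (metis disjoint_pre_def preT_def less_irrefl min_less_iff_conj)
qed

text \<open>Disjoint token sets in one cut let both transitions fire in a single step, so the
  structural conflict property applies. Sharing a token and sharing a preplace thus coincide for
  enabled events.\<close>

lemma en_disjoint:
  assumes "cfg V" "e \<in> en V" "f \<in> en V" "pre e \<inter> pre f = {}"
  shows "disjoint_pre N (tr e) (tr f)"
proof -
  have "cnt (pre e) s + cnt (pre f) s \<le> cnt (cut V) s" for s
    using cnt_Un_disjoint[of "pre e" "pre f" s] cnt_mono[of "cut V" "pre e \<union> pre f" s]
      assms finite_cut by (auto simp: en_def)
  then have "enabled N (cnt (cut V)) ({#tr e#} + {#tr f#})"
    using assms by (auto simp: enabled_def fires_def preG_def en_def add.commute)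
  then have "concurrent N (tr e) (tr f)"
    using reachable_cut[OF assms(1)] by (auto simp: concurrent_def)
  then show ?thesis
    using scn assms by (auto simp: structural_conflict_net_def en_def)
qed

text \<open>Otherwise the three transitions would form a pure M, fully marked by the reachable
  marking of the cut.\<close>

lemma conflict_trans:
  assumes V: "cfg V" and e: "e \<in> en V" and f: "f \<in> en V" and g: "g \<in> en V"
    and ef: "pre e \<inter> pre f \<noteq> {}" and fg: "pre f \<inter> pre g \<noteq> {}"
  shows "pre e \<inter> pre g \<noteq> {}"
proof
  assume "pre e \<inter> pre g = {}"
  then have "disjoint_pre N (tr e) (tr g)"
    using en_disjoint assms by blast
  moreover have "\<not> disjoint_pre N (tr e) (tr f)" "\<not> disjoint_pre N (tr f) (tr g)"
    using en_share assms by auto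
  moreover have "\<forall>s. max (max (preT N (tr e) s) (preT N (tr f) s)) (preT N (tr g) s) \<le> cnt (cut V) s"
    using en_le assms by (auto simp: preT_def)
  ultimately show False
    using noM reachable_cut[OF V] e f g unfolding fully_reachable_pure_M_def en_def by blast
qed

section \<open>Chains of configurations\<close>

text \<open>In the order in which \<open>C\<close> was built, the first event outside
  \<open>V\<close> depends on events of \<open>V\<close> only.\<close>

lemma cfg_next_closed:
  "cfg C \<Longrightarrow> \<not> C \<subseteq> V \<Longrightarrow> \<exists>x\<in>C - V. pre x \<subseteq> init_conds \<union> \<Union>(post ` V)"
proof (induction rule: cfg.induct)
  case (cfg_insert C e)
  show ?case
  proof (cases "C \<subseteq> V")
    case True
    have "pre e \<subseteq> init_conds \<union> \<Union>(post ` C)"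
      using cfg_insert.hyps unfolding en_def cut_def by blast
    with True have "pre e \<subseteq> init_conds \<union> \<Union>(post ` V)"
      by blast
    moreover have "e \<notin> V" using True cfg_insert.prems by blast
    ultimately show ?thesis by blast
  next
    case False
    then show ?thesis using cfg_insert.IH by blast
  qed
qed simp

lemma cfg_valid: "cfg C \<Longrightarrow> x \<in> C \<Longrightarrow> tr x \<in> transs N \<and> (\<forall>s. cnt (pre x) s = Fpt N s (tr x))"
  by (induction rule: cfg.induct) (auto simp: en_def)

text \<open>The causes of \<open>x\<close> are in \<open>V\<close>, and no event of \<open>V\<close>
  took its tokens because the events of \<open>C\<close> are pairwise conflict-free.\<close>

lemma cfg_next:
  assumes "cfg C" "V \<subseteq> C" "V \<noteq> C"
  obtains x where "x \<in> C" "x \<in> en V"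
proof -
  obtain x where x: "x \<in> C - V" "pre x \<subseteq> init_conds \<union> \<Union>(post ` V)"
    using cfg_next_closed[of C V] assms by blast
  moreover have "pre x \<inter> \<Union>(pre ` V) = {}"
    using cfg_disjoint[OF assms(1)] x assms by fastforce
  ultimately have "pre x \<subseteq> cut V"
    by (auto simp: cut_def)
  then show ?thesis
    using that x cfg_valid[OF assms(1)] by (auto simp: en_def)
qed

lemma cut_between: "b \<in> cut V \<Longrightarrow> b \<in> cut C \<Longrightarrow> V \<subseteq> W \<Longrightarrow> W \<subseteq> C \<Longrightarrow> b \<in> cut W"
  by (auto simp: cut_def)

text \<open>Downward induction from \<open>C\<close> to a subconfiguration \<open>V\<close>, on the
  number of missing events; \<open>cfg_next\<close> supplies one that can be added.\<close>

lemma cfg_between_induct [consumes 3, case_names top step]: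
  assumes "cfg V" "cfg C" "V \<subseteq> C"
    and top: "P C"
    and step: "\<And>V x. cfg V \<Longrightarrow> x \<in> C \<Longrightarrow> x \<in> en V \<Longrightarrow> insert x V \<subseteq> C \<Longrightarrow>
      P (insert x V) \<Longrightarrow> P V"
  shows "P V"
  using assms(1,3)
proof (induction "card (C - V)" arbitrary: V rule: less_induct)
  case less
  show ?case
  proof (cases "V = C")
    case False
    then obtain x where x: "x \<in> C" "x \<in> en V"
      using cfg_next less assms by metis
    then have "card (C - insert x V) < card (C - V)"
      using en_notin cfg_finite[OF assms(2)] by (intro psubset_card_mono) auto
    then show ?thesis
      using step[of V x] x less cfg_insert[of V x] by auto
  qed (use top in simp)
qed

text \<open>An event that competes with \<open>d\<close> stays enabled as long as \<open>d\<close> does: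
whatever disabled it would conflict with \<open>d\<close> too.\<close>
lemma rival_persists:
  assumes "cfg V" "cfg C" "V \<subseteq> C" "d \<in> en C" "d \<in> en V" "f \<in> en V" "pre f \<inter> pre d \<noteq> {}"
  shows "f \<in> en C"
  using assms(1-3,5,6)
proof (induction rule: cfg_between_induct)
  case (step V x)
  \<comment> \<open>The tokens of \<open>d\<close> are present at both ends of the chain, hence
    throughout.\<close>
  have d: "d \<in> en (insert x V)"
    using cut_between[where V=V and W="insert x V" and C=C] step assms(4) unfolding en_def by blast
  then have "pre x \<inter> pre d = {}"
    by (auto simp: en_def cut_def)
  then have "pre x \<inter> pre f = {}"
    using conflict_trans[of V x f d] step assms(7) by blast
  then have "f \<in> en (insert x V)"
    using step by (auto simp: en_def cut_insert)
  then show ?case using step d by blast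
qed

section \<open>Finiteness and countability of the unfolding\<close>

text \<open>A transition and a subset of the finite cut determine the event, and only finitely many
  transitions are enabled.\<close>

lemma finite_en: assumes "cfg V" shows "finite (en V)"
proof -
  let ?T = "{t \<in> transs N. enabled N (cnt (cut V)) {#t#}}"
  have "finite (?T \<times> Pow (cut V))"
    using fin reachable_cut[OF assms] finite_cut[OF assms] by (auto simp: finitary_def)
  moreover have "inj_on (\<lambda>e. (tr e, pre e)) (en V)"
    by (auto simp: inj_on_def pre_def fset_inject intro: ev.expand)
  moreover have "(\<lambda>e. (tr e, pre e)) ` en V \<subseteq> ?T \<times> Pow (cut V)"
    using en_le[OF assms] by (auto simp: en_def enabled_single)
  ultimately show ?thesis
    by (rule inj_on_finite[rotated 2])
qed

text \<open>By finite branching there are finitely many configurations of each size. This will make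
  the distributed net countable, so that it can be encoded in the prescribed universe.\<close>

lemma countable_cfg: "countable {V. cfg V}"
proof -
  have "finite {V. cfg V \<and> card V = n}" for n
  proof (induction n)
    case 0
    have "{V. cfg V \<and> card V = 0} \<subseteq> {{}}"
      using cfg_finite by auto
    then show ?case
      using finite_subset by blast
  next
    case (Suc n)
    have "{V. cfg V \<and> card V = Suc n} \<subseteq> (\<Union>V\<in>{V. cfg V \<and> card V = n}. (\<lambda>e. insert e V) ` en V)"
    proof
      fix W assume "W \<in> {V. cfg V \<and> card V = Suc n}"
      then have "cfg W" "card W = Suc n" by auto
      then show "W \<in> (\<Union>V\<in>{V. cfg V \<and> card V = n}. (\<lambda>e. insert e V) ` en V)"
      proof (cases rule: cfg.cases)
        case (cfg_insert V e)
        then have "card V = n"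
          using \<open>card W = Suc n\<close> en_notin cfg_finite by (metis card_insert_disjoint nat.inject)
        then show ?thesis using cfg_insert by auto
      qed simp
    qed
    then show ?case
      using Suc finite_en by (auto intro: finite_subset)
  qed
  then have "countable (\<Union>n. {V. cfg V \<and> card V = n})"
    by (intro countable_UN) (auto intro: countable_finite)
  moreover have "{V. cfg V} = (\<Union>n. {V. cfg V \<and> card V = n})" by auto
  ultimately show ?thesis by simp
qed

end

subsection \<open>The distributed net\<close>

text \<open>Locations are pairs \<open>(V, K)\<close> of a configuration and a clique. \<open>Tok b V\<close> holds a token on
condition \<open>b\<close> that knows \<open>V\<close>, \<open>Ctl V K\<close> is the control place of its location, and \<open>Done x V K\<close>
holds the message to that location that \<open>x\<close> has finished. Accordingly \<open>Fire e V\<close> executes \<open>e\<close>, and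
by \<open>Learn b V x\<close> the token on \<open>b\<close> reads about \<open>x\<close>.\<close>
datatype ('s, 't) dplace =
    Tok "('s, 't) cond" "('s, 't) ev set"
  | Ctl "('s, 't) ev set" "('s, 't) ev set"
  | Done "('s, 't) ev" "('s, 't) ev set" "('s, 't) ev set"

datatype ('s, 't) dtrans =
    Fire "('s, 't) ev" "('s, 't) ev set"
  | Learn "('s, 't) cond" "('s, 't) ev set" "('s, 't) ev"

text \<open>Arcs and the markings of interest are 0/1-valued, so that the token game becomes set
  algebra.\<close>

definition ind :: "'p set \<Rightarrow> 'p \<Rightarrow> nat" where
  "ind A p = (if p \<in> A then 1 else 0)"

lemma ind_diff: "ind A p - ind B p = ind (A - B) p"
  by (simp add: ind_def)

lemma ind_add: "A \<inter> B = {} \<Longrightarrow> ind A p + ind B p = ind (A \<union> B) p"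
  by (auto simp: ind_def)

lemma ind_le_iff: "(\<forall>p. ind A p \<le> ind B p) \<longleftrightarrow> A \<subseteq> B"
  by (auto simp: ind_def split: if_splits)

context unfolding_net
begin

definition rivals :: "('s, 't) ev set \<Rightarrow> ('s, 't) ev \<Rightarrow> ('s, 't) ev set" where
  "rivals V e = {g \<in> en V. pre e \<inter> pre g \<noteq> {}}"

text \<open>The clique as seen from a condition. It is empty if no event enabled at \<open>V\<close>
  consumes \<open>b\<close>; such a token resides at \<open>(V, {})\<close> and can still learn
  there.\<close>

definition rivals_at :: "('s, 't) ev set \<Rightarrow> ('s, 't) cond \<Rightarrow> ('s, 't) ev set" where
  "rivals_at V b = {g \<in> en V. \<exists>f\<in>en V. b \<in> pre f \<and> pre f \<inter> pre g \<noteq> {}}"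

definition locs :: "(('s, 't) ev set \<times> ('s, 't) ev set) set" where
  "locs = {(V, K). cfg V \<and> K \<subseteq> en V}"

fun consumes :: "('s, 't) dtrans \<Rightarrow> ('s, 't) dplace set" where
  "consumes (Fire e V) = (\<lambda>b. Tok b V) ` pre e \<union> {Ctl V (rivals V e)}"
| "consumes (Learn b V x) = {Tok b V, Ctl V (rivals_at V b), Done x V (rivals_at V b)}"

text \<open>\<open>Fire\<close> returns the control token only on completion, so its location is
  blocked meanwhile. \<open>Learn\<close> puts the message back, so every token at the location can
  read it.\<close>

fun produces :: "('s, 't) dtrans \<Rightarrow> ('s, 't) dplace set" where
  "produces (Fire e V) = (\<lambda>b. Tok b (insert e V)) ` post e \<union> {Ctl V (rivals V e)} \<union>
     (\<lambda>(W, K). Done e W K) ` locs"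
| "produces (Learn b V x) = {Tok b (insert x V), Ctl V (rivals_at V b), Done x V (rivals_at V b)}"

fun dlab :: "('s, 't) dtrans \<Rightarrow> 'a option" where
  "dlab (Fire e V) = lab N (tr e)"
| "dlab (Learn b V x) = None"

text \<open>The guards on \<open>Learn\<close> keep the knowledge of a token a configuration in
  whose cut the token still lies.\<close>

definition dtranss :: "('s, 't) dtrans set" where
  "dtranss = {Fire e V | e V. cfg V \<and> e \<in> en V} \<union>
     {Learn b V x | b V x. cfg V \<and> x \<in> en V \<and> b \<in> cut V - pre x}"

definition dplaces :: "('s, 't) dplace set" where
  "dplaces = {Tok b V | b V. cfg V \<and> b \<in> cut V} \<union> {Ctl V K | V K. (V, K) \<in> locs} \<union>
     {Done x V K | x V K. (V, K) \<in> locs \<and> (\<exists>W. cfg W \<and> x \<in> en W)}"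

definition dnet :: "(('s, 't) dplace, ('s, 't) dtrans, 'a) pnet" where
  "dnet = \<lparr> places = dplaces, transs = dtranss,
     Fpt = (\<lambda>p t. if t \<in> dtranss then ind (consumes t) p else 0),
     Ftp = (\<lambda>t p. if t \<in> dtranss then ind (produces t) p else 0),
     M0 = ind ((\<lambda>b. Tok b {}) ` init_conds \<union> (\<lambda>(V, K). Ctl V K) ` locs),
     lab = dlab \<rparr>"

lemma dnet_simps [simp]:
  "places dnet = dplaces" "transs dnet = dtranss" "lab dnet = dlab"
  "M0 dnet = ind ((\<lambda>b. Tok b {}) ` init_conds \<union> (\<lambda>(V, K). Ctl V K) ` locs)"
  "t \<in> dtranss \<Longrightarrow> Fpt dnet p t = ind (consumes t) p"
  "t \<in> dtranss \<Longrightarrow> Ftp dnet t p = ind (produces t) p"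
  "t \<in> dtranss \<Longrightarrow> preT dnet t p = ind (consumes t) p"
  "t \<in> dtranss \<Longrightarrow> postT dnet t p = ind (produces t) p"
  by (simp_all add: dnet_def preT_def postT_def)

text \<open>By transitivity of conflict, every precondition of \<open>e\<close> sees the same
  clique. This places all inputs of \<open>Fire e V\<close> at one location.\<close>

lemma rivals_at_eq:
  assumes "cfg V" "e \<in> en V" "b \<in> pre e"
  shows "rivals_at V b = rivals V e"
proof
  show "rivals V e \<subseteq> rivals_at V b"
    using assms by (auto simp: rivals_def rivals_at_def)
  show "rivals_at V b \<subseteq> rivals V e"
  proof
    fix g assume "g \<in> rivals_at V b"
    then obtain f where "g \<in> en V" "f \<in> en V" "b \<in> pre f" "pre f \<inter> pre g \<noteq> {}"
      by (auto simp: rivals_at_def)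
    then show "g \<in> rivals V e"
      using conflict_trans[of V e f g] assms unfolding rivals_def by blast
  qed
qed

lemma locs_rivals: "cfg V \<Longrightarrow> (V, rivals V e) \<in> locs" "cfg V \<Longrightarrow> (V, rivals_at V b) \<in> locs"
  by (auto simp: locs_def rivals_def rivals_at_def)

lemma consumes_places: "t \<in> dtranss \<Longrightarrow> consumes t \<subseteq> dplaces"
  using locs_rivals en_cut by (auto simp: dtranss_def dplaces_def) blast+

lemma produces_places: "t \<in> dtranss \<Longrightarrow> produces t \<subseteq> dplaces"
proof -
  assume "t \<in> dtranss"
  then consider (Fire) e V where "t = Fire e V" "cfg V" "e \<in> en V"
    | (Learn) b V x where "t = Learn b V x" "cfg V" "x \<in> en V" "b \<in> cut V - pre x"
    by (auto simp: dtranss_def)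
  then show ?thesis
  proof cases
    case Fire
    then show ?thesis
      using locs_rivals cfg_insert cut_insert by (auto simp: dplaces_def)
  next
    case Learn
    then show ?thesis
      using locs_rivals cfg_insert cut_insert by (auto simp: dplaces_def)
  qed
qed

lemma wf_dnet: "wf_net dnet"
proof -
  have "cut {} = init_conds"
    by (simp add: cut_def)
  then have "ind ((\<lambda>b. Tok b {}) ` init_conds \<union> (\<lambda>(V, K). Ctl V K) ` locs) p \<noteq> 0 \<Longrightarrow> p \<in> dplaces"
    for p using cfg_empty by (auto simp: ind_def dplaces_def split: if_splits)
  then show ?thesis
    using consumes_places produces_places
    unfolding wf_net_def dnet_def ind_def by (simp split: if_splits) blast
qed

section \<open>Locations and distributedness\<close>

text \<open>Naming a location by its control place gives a location function with values among the
  nodes of the net.\<close>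

fun ctl_of :: "('s, 't) dtrans \<Rightarrow> ('s, 't) dplace" where
  "ctl_of (Fire e V) = Ctl V (rivals V e)"
| "ctl_of (Learn b V x) = Ctl V (rivals_at V b)"

fun home :: "('s, 't) dplace \<Rightarrow> ('s, 't) dplace" where
  "home (Tok b V) = Ctl V (rivals_at V b)"
| "home (Ctl V K) = Ctl V K"
| "home (Done x V K) = Ctl V K"

lemma home_consumes: "t \<in> dtranss \<Longrightarrow> p \<in> consumes t \<Longrightarrow> home p = ctl_of t"
  using rivals_at_eq by (auto simp: dtranss_def)

lemma ctl_consumes: "ctl_of t \<in> consumes t"
  by (cases t) auto

lemma ctl_balance: "Ctl V K \<in> consumes t \<longleftrightarrow> Ctl V K \<in> produces t"
  by (cases t) auto

text \<open>Each transition returns exactly the control token it takes, so a step leaves every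
  control place at its initial count.\<close>

lemma ctl_bounded: "reachable dnet m \<Longrightarrow> m (Ctl V K) \<le> 1"
proof (induction rule: reachable.induct)
  case init
  then show ?case by (simp add: ind_def)
next
  case (step m G m')
  have "preG dnet G (Ctl V K) = postG dnet G (Ctl V K)"
    using ctl_balance by (auto simp: preG_def postG_def dnet_def ind_def
        intro!: arg_cong[where f=sum_mset] image_mset_cong)
  then show ?case
    using step by (auto simp: fires_def)
qed

lemma distributed_dnet: "distributed dnet"
proof -
  have "ctl_of t \<noteq> ctl_of u" if tu: "t \<in> dtranss" "u \<in> dtranss" "concurrent dnet t u" for t u
  proof
    assume eq: "ctl_of t = ctl_of u"
    obtain m where m: "reachable dnet m" "\<forall>p. preG dnet ({#t#} + {#u#}) p \<le> m p"
      using tu unfolding concurrent_def enabled_def fires_def by blast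
    \<comment> \<open>Two concurrent transitions at one location would need two copies of its
      control token.\<close>
    have "preG dnet ({#t#} + {#u#}) (ctl_of t) = 2"
      using tu eq ctl_consumes[of t] ctl_consumes[of u] by (simp add: preG_def ind_def)
    moreover obtain V K where "ctl_of t = Ctl V K"
      by (cases t) auto
    ultimately show False
      using m(2)[rule_format, of "ctl_of t"] ctl_bounded[OF m(1), of V K] by simp
  qed
  then show ?thesis
    unfolding distributed_def
    by (intro exI[of _ "case_sum (\<lambda>p. Inl (home p)) (\<lambda>t. Inl (ctl_of t))"])
      (auto simp: ind_def home_consumes split: if_splits)
qed

lemma countable_dplaces: "countable dplaces"
proof -
  let ?F = "\<lambda>V. (\<lambda>b. Tok b V) ` cut V \<union> (\<lambda>K. Ctl V K) ` Pow (en V) \<union>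
    (\<Union>W\<in>{W. cfg W}. (\<lambda>(x, K). Done x V K) ` (en W \<times> Pow (en V)))"
  have "countable (?F V)" if "cfg V" for V
    using finite_cut finite_en that countable_cfg by (intro countable_Un countable_UN)
      (auto intro!: countable_finite)
  then have "countable (\<Union>V\<in>{V. cfg V}. ?F V)"
    using countable_cfg by blast
  moreover have "dplaces \<subseteq> (\<Union>V\<in>{V. cfg V}. ?F V)"
    unfolding dplaces_def locs_def by fastforce
  ultimately show ?thesis
    using countable_subset by blast
qed

lemma countable_dtranss: "countable dtranss"
proof -
  let ?F = "\<lambda>V. (\<lambda>e. Fire e V) ` en V \<union> (\<lambda>(b, x). Learn b V x) ` (cut V \<times> en V)"
  have "countable (?F V)" if "cfg V" for V
    using finite_cut finite_en that by (auto intro!: countable_finite)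
  then have "countable (\<Union>V\<in>{V. cfg V}. ?F V)"
    using countable_cfg by blast
  moreover have "dtranss \<subseteq> (\<Union>V\<in>{V. cfg V}. ?F V)"
    by (auto simp: dtranss_def)
  ultimately show ?thesis
    using countable_subset by blast
qed

end

subsection \<open>Reachable states of the distributed net\<close>

text \<open>Tokens are chosen place by place. This turns an enabled transition of \<open>N\<close>
  into an event.\<close>

lemma cnt_subset_exists:
  assumes "finite A" "\<And>s. n s \<le> cnt A s"
  obtains B where "B \<subseteq> A" "\<And>s. cnt B s = n s"
proof -
  have "\<exists>B. B \<subseteq> {b \<in> A. place_of b = s} \<and> card B = n s" for s
    by (rule obtain_subset_with_card_n[OF assms(2)[of s, unfolded cnt_def]]) blast
  then obtain B where B: "\<And>s. B s \<subseteq> {b \<in> A. place_of b = s}" "\<And>s. card (B s) = n s"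
    by metis
  have "{b \<in> \<Union>(range B). place_of b = s} = B s" for s
    using B(1) by blast
  then have "cnt (\<Union>(range B)) s = n s" for s
    using B(2) by (simp add: cnt_def)
  then show ?thesis
    using that[of "\<Union>(range B)"] B(1) by blast
qed

lemma pre_exists: "finite B \<Longrightarrow> \<exists>e. tr e = t \<and> pre e = B"
  by (intro exI[of _ "Ev t (Abs_fset B)"]) (simp add: pre_def Abs_fset_inverse)

context unfolding_net
begin

text \<open>A reachable state is described by the configuration \<open>C\<close> of finished events, the knowledge
\<open>k b\<close> of the token on each available condition \<open>b\<close>, and the list \<open>L\<close> of events in progress, each
with the configuration at which it was fired.\<close>
definition avail :: "('s, 't) ev set \<Rightarrow> (('s, 't) ev \<times> ('s, 't) ev set) list \<Rightarrow> ('s, 't) cond set" where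
  "avail C L = cut C - \<Union>((\<lambda>(e, W). pre e) ` set L)"

definition busy :: "(('s, 't) ev \<times> ('s, 't) ev set) list \<Rightarrow> (('s, 't) ev set \<times> ('s, 't) ev set) set" where
  "busy L = (\<lambda>(e, W). (W, rivals W e)) ` set L"

definition marked :: "('s, 't) ev set \<Rightarrow> (('s, 't) cond \<Rightarrow> ('s, 't) ev set) \<Rightarrow>
    (('s, 't) ev \<times> ('s, 't) ev set) list \<Rightarrow> ('s, 't) dplace set" where
  "marked C k L = (\<lambda>b. Tok b (k b)) ` avail C L \<union> (\<lambda>(V, K). Ctl V K) ` (locs - busy L) \<union>
     {Done x V K | x V K. x \<in> C \<and> (V, K) \<in> locs}"

text \<open>Events in progress are not yet in \<open>C\<close> and still count as enabled there. As
  the relation is symmetric, \<open>sorted_wrt\<close> expresses pairwise disjointness over list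
  positions, which also excludes repetitions.\<close>

definition good :: "('s, 't) ev set \<Rightarrow> (('s, 't) cond \<Rightarrow> ('s, 't) ev set) \<Rightarrow>
    (('s, 't) ev \<times> ('s, 't) ev set) list \<Rightarrow> bool" where
  "good C k L \<longleftrightarrow> cfg C \<and> (\<forall>b\<in>avail C L. cfg (k b) \<and> k b \<subseteq> C \<and> b \<in> cut (k b)) \<and>
     (\<forall>(e, W)\<in>set L. cfg W \<and> W \<subseteq> C \<and> e \<in> en W \<and> e \<in> en C) \<and>
     sorted_wrt (\<lambda>p q. pre (fst p) \<inter> pre (fst q) = {}) L"

lemma marked_simps [simp]:
  "Tok b V \<in> marked C k L \<longleftrightarrow> b \<in> avail C L \<and> V = k b"
  "Ctl V K \<in> marked C k L \<longleftrightarrow> (V, K) \<in> locs \<and> (V, K) \<notin> busy L"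
  "Done x V K \<in> marked C k L \<longleftrightarrow> x \<in> C \<and> (V, K) \<in> locs"
  by (auto simp: marked_def)

lemma dplace_set_eqI:
  assumes "\<And>b V. Tok b V \<in> A \<longleftrightarrow> Tok b V \<in> B" "\<And>V K. Ctl V K \<in> A \<longleftrightarrow> Ctl V K \<in> B"
    "\<And>x V K. Done x V K \<in> A \<longleftrightarrow> Done x V K \<in> B"
  shows "A = B"
proof (rule set_eqI)
  fix p show "p \<in> A \<longleftrightarrow> p \<in> B"
    using assms by (cases p) auto
qed

lemma good_en: "good C k L \<Longrightarrow> (e, W) \<in> set L \<Longrightarrow> e \<in> en C \<and> e \<in> en W \<and> cfg W \<and> W \<subseteq> C"
  by (auto simp: good_def)

lemma avail_snoc: "avail C (L @ [(e, W)]) = avail C L - pre e"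
  by (auto simp: avail_def)

lemma avail_subset: "avail C L \<subseteq> cut C"
  by (auto simp: avail_def)

lemma good_finite_avail: "good C k L \<Longrightarrow> finite (avail C L)"
  using finite_subset[OF avail_subset finite_cut] by (simp add: good_def)

text \<open>An event \<open>d\<close> occupying this location would be in its own clique, hence in
  that of \<open>e\<close>, and would share a condition with \<open>e\<close>.\<close>

lemma home_not_busy:
  assumes "cfg V" "e \<in> en V" "\<And>d W. (d, W) \<in> set L \<Longrightarrow> d \<in> en W \<and> pre e \<inter> pre d = {}"
  shows "(V, rivals V e) \<notin> busy L"
proof
  assume "(V, rivals V e) \<in> busy L"
  then obtain d where d: "(d, V) \<in> set L" "rivals V e = rivals V d"
    by (auto simp: busy_def)
  then have "d \<in> rivals V d"
    using assms(3)[OF d(1)] pre_nonempty[of d V] by (auto simp: rivals_def)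
  then show False
    using d assms(3)[OF d(1)] by (auto simp: rivals_def)
qed

text \<open>The control token is present by \<open>home_not_busy\<close>: events in progress hold
  tokens disjoint from the available ones that \<open>e\<close> uses.\<close>

lemma start_good:
  assumes good: "good C k L" and W: "cfg W" and e: "e \<in> en W"
    and av: "pre e \<subseteq> avail C L" and k: "\<And>b. b \<in> pre e \<Longrightarrow> k b = W"
  shows "good C k (L @ [(e, W)])"
    and "consumes (Fire e W) \<subseteq> marked C k L"
    and "marked C k (L @ [(e, W)]) = marked C k L - consumes (Fire e W)"
    and "cnt (avail C (L @ [(e, W)])) s = cnt (avail C L) s - Fpt N s (tr e)"
    and "Fpt N s (tr e) \<le> cnt (avail C L) s"
proof -
  obtain b where "b \<in> pre e" using pre_nonempty e by blast
  then have WC: "W \<subseteq> C"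
    using good av k unfolding good_def by blast
  have enC: "e \<in> en C"
    using e av avail_subset unfolding en_def by blast
  have dis: "pre d \<inter> pre e = {}" if "(d, V) \<in> set L" for d V
    using av that by (auto simp: avail_def)
  then have "\<forall>p\<in>set L. pre (fst p) \<inter> pre e = {}"
    by force
  then show "good C k (L @ [(e, W)])"
    using good W e WC enC unfolding good_def avail_snoc by (auto simp: sorted_wrt_append)
  have "(W, rivals W e) \<notin> busy L"
    using home_not_busy W e good_en[OF good] dis by (metis Int_commute)
  then show "consumes (Fire e W) \<subseteq> marked C k L"
    using W av k locs_rivals by auto
  show "marked C k (L @ [(e, W)]) = marked C k L - consumes (Fire e W)"
    by (rule dplace_set_eqI) (use av k in \<open>auto simp: avail_snoc busy_def\<close>)
  have cp: "cnt (pre e) s = Fpt N s (tr e)"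
    using e by (simp add: en_def)
  show "cnt (avail C (L @ [(e, W)])) s = cnt (avail C L) s - Fpt N s (tr e)"
    using cnt_Diff[OF good_finite_avail[OF good] av] cp by (simp add: avail_snoc)
  show "Fpt N s (tr e) \<le> cnt (avail C L) s"
    using cnt_mono[OF good_finite_avail[OF good] av] cp by metis
qed

text \<open>The new tokens know \<open>insert e W\<close>, because the location that fired
  \<open>e\<close> had heard of \<open>W\<close> only. All products are fresh, so the marking stays
  0/1-valued.\<close>

lemma finish_good:
  fixes L1 L2 e W k
  defines "k' \<equiv> \<lambda>b. if b \<in> post e then insert e W else k b"
  assumes good: "good C k (L1 @ (e, W) # L2)"
  shows "good (insert e C) k' (L1 @ L2)"
    and "marked C k (L1 @ (e, W) # L2) \<inter> produces (Fire e W) = {}"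
    and "marked (insert e C) k' (L1 @ L2) = marked C k (L1 @ (e, W) # L2) \<union> produces (Fire e W)"
    and "cnt (avail (insert e C) (L1 @ L2)) s = cnt (avail C (L1 @ (e, W) # L2)) s + Ftp N (tr e) s"
proof -
  let ?L = "L1 @ (e, W) # L2"
  have C: "cfg C" and eC: "e \<in> en C" and W: "cfg W" "W \<subseteq> C" "e \<in> en W"
    using good by (auto simp: good_def)
  have dis: "pre e \<inter> pre d = {}" if "(d, V) \<in> set (L1 @ L2)" for d V
    using good that unfolding good_def by (fastforce simp: sorted_wrt_append)
  have cutC: "cut (insert e C) = cut C - pre e \<union> post e"
    using cut_insert C eC by blast
  have cutW: "cut (insert e W) = cut W - pre e \<union> post e"
    using cut_insert W by blast
  have pc: "post e \<inter> cut C = {}"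
    using post_notin_cut en_notin eC by blast
  have preL: "pre d \<subseteq> cut C" if "(d, V) \<in> set (L1 @ L2)" for d V
    using good_en[OF good, of d V] that en_cut by auto
  have av: "avail (insert e C) (L1 @ L2) = avail C ?L \<union> post e"
    using preL pc dis unfolding avail_def cutC by fastforce
  have pa: "post e \<inter> avail C ?L = {}"
    using pc avail_subset by blast
  \<comment> \<open>The other events in progress stay enabled since \<open>e\<close> took none of
    their tokens.\<close>
  have "cfg V \<and> V \<subseteq> insert e C \<and> d \<in> en V \<and> d \<in> en (insert e C)"
    if "(d, V) \<in> set (L1 @ L2)" for d V
  proof -
    have "d \<in> en C \<and> d \<in> en V \<and> cfg V \<and> V \<subseteq> C"
      using good_en[OF good, of d V] that by auto
    then show ?thesis
      using dis[OF that] by (auto simp: en_def cutC)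
  qed
  then have "\<forall>(d, V)\<in>set (L1 @ L2). cfg V \<and> V \<subseteq> insert e C \<and> d \<in> en V \<and> d \<in> en (insert e C)"
    by blast
  moreover have "sorted_wrt (\<lambda>p q. pre (fst p) \<inter> pre (fst q) = {}) (L1 @ L2)"
    using good by (simp add: good_def sorted_wrt_append)
  moreover have "cfg (k' b) \<and> k' b \<subseteq> insert e C \<and> b \<in> cut (k' b)"
    if "b \<in> avail (insert e C) (L1 @ L2)" for b
  proof (cases "b \<in> post e")
    case True
    then show ?thesis using W cfg_insert cutW by (auto simp: k'_def)
  next
    case False
    then show ?thesis using that good unfolding av good_def k'_def by auto
  qed
  ultimately show "good (insert e C) k' (L1 @ L2)"
    using cfg_insert[OF C eC] unfolding good_def by blast
  \<comment> \<open>No other event in progress occupies the location, so finishing \<open>e\<close>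
    frees it.\<close>
  have "(W, rivals W e) \<notin> busy (L1 @ L2)"
    using home_not_busy[of W e "L1 @ L2"] W good_en[OF good] dis by auto
  then have busy: "busy ?L = insert (W, rivals W e) (busy (L1 @ L2))" "(W, rivals W e) \<notin> busy (L1 @ L2)"
    by (auto simp: busy_def)
  show "marked C k ?L \<inter> produces (Fire e W) = {}"
    using pa en_notin[OF eC] busy by auto
  show "marked (insert e C) k' (L1 @ L2) = marked C k ?L \<union> produces (Fire e W)"
    by (rule dplace_set_eqI) (use av pa busy locs_rivals(1)[OF W(1)] in \<open>auto simp: k'_def\<close>)
  show "cnt (avail (insert e C) (L1 @ L2)) s = cnt (avail C ?L) s + Ftp N (tr e) s"
    unfolding av using pa good_finite_avail[OF good] finite_post[OF C eC]
    by (subst cnt_Un_disjoint) (auto simp: cnt_post)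
qed

text \<open>The message shows that \<open>x\<close> has finished, while enabledness at
  \<open>W\<close> shows that it is new to the token; so knowledge grows strictly within
  \<open>C\<close>.\<close>

lemma learn_good:
  assumes good: "good C k L" and t: "Learn b W x \<in> dtranss" and con: "consumes (Learn b W x) \<subseteq> marked C k L"
  shows "k b = W" "b \<in> avail C L" "x \<in> C - W" "good C (k(b := insert x W)) L"
    and "(marked C k L - consumes (Learn b W x)) \<inter> produces (Learn b W x) = {}"
    and "marked C (k(b := insert x W)) L = (marked C k L - consumes (Learn b W x)) \<union> produces (Learn b W x)"
proof -
  have x: "cfg W" "x \<in> en W" "b \<in> cut W" "b \<notin> pre x"
    using t by (auto simp: dtranss_def)
  show k: "k b = W" "b \<in> avail C L"
    using con by auto
  show xC: "x \<in> C - W"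
    using con en_notin[OF x(2)] by auto
  have "b \<in> cut (insert x W)" "cfg (insert x W)" "W \<subseteq> C"
    using cut_insert cfg_insert x good k unfolding good_def by auto
  then show "good C (k(b := insert x W)) L"
    using good xC unfolding good_def by auto
  have "insert x W \<noteq> W"
    using xC by blast
  then show "(marked C k L - consumes (Learn b W x)) \<inter> produces (Learn b W x) = {}"
    using k by auto
  show "marked C (k(b := insert x W)) L = (marked C k L - consumes (Learn b W x)) \<union> produces (Learn b W x)"
    by (rule dplace_set_eqI) (use con k \<open>insert x W \<noteq> W\<close> in auto)
qed

abbreviation dtau where
  "dtau \<equiv> \<lambda>x y. st_step dnet x Tau y"

lemma learn_step:
  assumes "good C k L" "Learn b W x \<in> dtranss" "consumes (Learn b W x) \<subseteq> marked C k L"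
  shows "dtau (ind (marked C k L), U) (ind (marked C (k(b := insert x W)) L), U)"
proof -
  let ?t = "Learn b W x" and ?A = "marked C k L"
  have "(\<lambda>p. ind ?A p - Fpt dnet p ?t + Ftp dnet ?t p) = ind (marked C (k(b := insert x W)) L)"
    using ind_add[OF learn_good(5)[OF assms]] learn_good(6)[OF assms] assms(2)
    by (simp add: ind_diff del: consumes.simps produces.simps)
  then have "fires dnet (ind ?A) {#?t#} (ind (marked C (k(b := insert x W)) L))"
    using assms(2,3) by (simp add: fires_single ind_le_iff del: consumes.simps produces.simps)
  then show ?thesis
    using assms(2) by (intro st_step.tau[where t="?t"]) auto
qed

text \<open>While an event \<open>d\<close> is in progress its location is blocked, but every condition
waiting there belongs to a rival of \<open>d\<close> and hence to no event that is still executable.\<close>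
lemma location_free:
  assumes good: "good C k L" and e: "e \<in> en C" "pre e \<subseteq> avail C L" "b \<in> pre e"
    and V: "cfg V" "V \<subseteq> C"
  shows "(V, rivals_at V b) \<notin> busy L"
proof
  assume "(V, rivals_at V b) \<in> busy L"
  then obtain d where d: "(d, V) \<in> set L" "rivals_at V b = rivals V d"
    by (auto simp: busy_def)
  have den: "d \<in> en C" "d \<in> en V" and C: "cfg C"
    using good_en[OF good d(1)] good by (auto simp: good_def)
  then have "d \<in> rivals_at V b"
    using d pre_nonempty by (auto simp: rivals_def)
  then obtain f where f: "f \<in> en V" "b \<in> pre f" "pre f \<inter> pre d \<noteq> {}"
    by (auto simp: rivals_at_def)
  have "f \<in> en C"
    using rival_persists[OF V(1) C V(2) den f(1,3)] .
  then have "pre e \<inter> pre d \<noteq> {}"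
    using conflict_trans[OF C e(1) _ den(1), of f] f e(3) by blast
  then show False
    using e(2) d(1) by (auto simp: avail_def)
qed

text \<open>The token reads about the events of \<open>C - k b\<close> one at a time in causal
  order. At each stop \<open>location_free\<close> guarantees the control token.\<close>

lemma catch_up_one:
  assumes good: "good C k L" and e: "e \<in> en C" "pre e \<subseteq> avail C L" "b \<in> pre e"
  shows "good C (k(b := C)) L \<and> dtau\<^sup>*\<^sup>* (ind (marked C k L), U) (ind (marked C (k(b := C)) L), U)"
proof -
  have C: "cfg C" using good by (simp add: good_def)
  have kb: "cfg (k b)" "k b \<subseteq> C"
    using good e by (auto simp: good_def)
  \<comment> \<open>Quantified over \<open>k\<close>, since every learning step changes the
    knowledge function.\<close>
  have "\<forall>k. good C k L \<and> k b = V \<longrightarrow>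
      good C (k(b := C)) L \<and> dtau\<^sup>*\<^sup>* (ind (marked C k L), U) (ind (marked C (k(b := C)) L), U)"
    if "cfg V" "V \<subseteq> C" for V
    using that(1) C that(2)
  proof (induction rule: cfg_between_induct)
    case top
    then show ?case by (auto simp: fun_upd_idem)
  next
    case (step V x)
    show ?case
    proof (intro allI impI)
      fix k assume "good C k L \<and> k b = V"
      then have k: "good C k L" "k b = V" by auto
      have "b \<in> cut V" "V \<subseteq> C"
        using k e step by (auto simp: good_def)
      \<comment> \<open>\<open>x\<close> has finished, so a token it consumed could not be in
        \<open>cut C\<close>.\<close>
      moreover have "b \<notin> pre x"
        using e(2,3) step(2) avail_subset[of C L] by (auto simp: cut_def)
      ultimately have t: "Learn b V x \<in> dtranss"
        using step by (auto simp: dtranss_def)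
      have con: "consumes (Learn b V x) \<subseteq> marked C k L"
        using location_free[OF k(1) e step(1) \<open>V \<subseteq> C\<close>] locs_rivals(2)[OF step(1)] k e step(2) by auto
      have "dtau (ind (marked C k L), U) (ind (marked C (k(b := insert x V)) L), U)"
        using learn_step[OF k(1) t con] .
      moreover have "good C (k(b := insert x V)) L"
        using learn_good(4)[OF k(1) t con] .
      ultimately show "good C (k(b := C)) L \<and>
          dtau\<^sup>*\<^sup>* (ind (marked C k L), U) (ind (marked C (k(b := C)) L), U)"
        using step.IH[rule_format, of "k(b := insert x V)"]
        by (auto intro: converse_rtranclp_into_rtranclp)
    qed
  qed
  then show ?thesis
    using kb good by blast
qed

text \<open>The finitely many tokens of \<open>e\<close> catch up one after another; afterwards they
  all reside at one location and \<open>Fire e C\<close> becomes possible.\<close>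

lemma catch_up:
  assumes good: "good C k L" and e: "e \<in> en C" "pre e \<subseteq> avail C L"
  obtains k' where "good C k' L" "dtau\<^sup>*\<^sup>* (ind (marked C k L), U) (ind (marked C k' L), U)"
    "\<And>b. b \<in> pre e \<Longrightarrow> k' b = C"
proof -
  have "finite B \<Longrightarrow> B \<subseteq> pre e \<Longrightarrow> \<exists>k'. good C k' L \<and>
      dtau\<^sup>*\<^sup>* (ind (marked C k L), U) (ind (marked C k' L), U) \<and> (\<forall>b\<in>B. k' b = C)" for B
  proof (induction B rule: finite_induct)
    case empty
    then show ?case using good by auto
  next
    case (insert b B)
    then obtain k' where k': "good C k' L" "dtau\<^sup>*\<^sup>* (ind (marked C k L), U) (ind (marked C k' L), U)"
      "\<forall>b\<in>B. k' b = C" by auto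
    have "b \<in> pre e" using insert by auto
    note one = catch_up_one[OF k'(1) e this, of U]
    moreover have "\<forall>c\<in>insert b B. (k'(b := C)) c = C"
      using k'(3) by simp
    ultimately show ?case
      using rtranclp_trans[OF k'(2) conjunct2[OF one]] by blast
  qed
  from this[of "pre e"] show ?thesis
    using that by auto
qed

text \<open>The description is kept as parameters, so that silent steps can be seen to change
  \<open>k\<close> alone.\<close>

definition rel where
  "rel C k L x y \<longleftrightarrow> good C k L \<and>
     x = (ind (marked C k L), map (\<lambda>(e, W). Fire e W) L) \<and>
     y = (cnt (avail C L), map (\<lambda>(e, W). tr e) L)"

lemma rel_init: "rel {} (\<lambda>_. {}) [] (M0 dnet, []) (M0 N, [])"
proof -
  have "cut {} = init_conds"
    by (simp add: cut_def)
  then have "avail {} [] = init_conds"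
    by (simp add: avail_def)
  moreover have "good {} (\<lambda>_. {}) []"
    by (auto simp: good_def cfg_empty avail_def)
  ultimately show ?thesis
    by (auto simp: rel_def cnt_init busy_def marked_def)
qed

text \<open>The termination measure for silent steps: news still unread by available tokens.\<close>

definition lag where
  "lag C k L = (\<Sum>b\<in>avail C L. card (C - k b))"

lemma lag_learn:
  assumes "good C k L" "Learn b W x \<in> dtranss" "consumes (Learn b W x) \<subseteq> marked C k L"
  shows "lag C (k(b := insert x W)) L < lag C k L"
proof -
  note l = learn_good[OF assms]
  have "finite C"
    using assms(1) cfg_finite by (simp add: good_def)
  then have "card (C - insert x W) < card (C - k b)"
    using l(1,3) by (intro psubset_card_mono) auto
  then show ?thesis
    unfolding lag_def using l(2) good_finite_avail[OF assms(1)]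
    by (intro sum_strict_mono_ex1) auto
qed

end

subsection \<open>Branching ST-bisimilarity\<close>

context unfolding_net
begin

text \<open>\<open>Fire e W\<close> is matched by \<open>tr e\<close>. Both lists of running
  transitions are images of \<open>L\<close>, so positions in finish actions agree.\<close>

lemma rel_forward:
  assumes rel: "rel C k L x y" and step: "st_step dnet x \<alpha> x'" and na: "\<alpha> \<noteq> Tau"
  shows "\<exists>C k L y'. st_step N y \<alpha> y' \<and> rel C k L x' y'"
proof -
  have good: "good C k L"
    and x: "x = (ind (marked C k L), map (\<lambda>(e, W). Fire e W) L)"
    and y: "y = (cnt (avail C L), map (\<lambda>(e, W). tr e) L)"
    using rel by (auto simp: rel_def)
  from step[unfolded x] na show ?thesis
  proof (cases rule: st_step.cases)
    case (start t a)
    then obtain e W where t: "t = Fire e W" and W: "cfg W" "e \<in> en W"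
      by (auto simp: dtranss_def)
    have "consumes t \<subseteq> marked C k L"
      using start by (simp add: enabled_single ind_le_iff del: consumes.simps)
    \<comment> \<open>A token place \<open>Tok b W\<close> is marked only if \<open>b\<close> is
      available and its token knows exactly \<open>W\<close>.\<close>
    then have av: "pre e \<subseteq> avail C L" "\<And>b. b \<in> pre e \<Longrightarrow> k b = W"
      by (auto simp: t)
    note s = start_good[OF good W av]
    let ?L = "L @ [(e, W)]"
    have "x' = (ind (marked C k ?L), map (\<lambda>(e, W). Fire e W) ?L)"
      using start s(3) t by (simp add: ind_diff del: consumes.simps)
    moreover have "st_step N y (Start a) (\<lambda>s. cnt (avail C L) s - preT N (tr e) s, map (\<lambda>(e, W). tr e) L @ [tr e])"
      unfolding y using W start t s(5) by (intro st_step.start) (auto simp: enabled_single en_def)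
    moreover have "(\<lambda>s. cnt (avail C L) s - preT N (tr e) s) = cnt (avail C ?L)"
      using s(4) by (auto simp: preT_def)
    ultimately show ?thesis
      using s(1) start by (intro exI[of _ C] exI[of _ k] exI[of _ ?L]) (auto simp: rel_def)
  next
    case (finish n a)
    define L1 L2 where "L1 = take n L" and "L2 = drop (Suc n) L"
    obtain e W where eW: "L ! n = (e, W)" by fastforce
    have n: "n < length L" using finish by simp
    have L: "L = L1 @ (e, W) # L2"
      using id_take_nth_drop[OF n] eW by (simp add: L1_def L2_def)
    have t: "Fire e W \<in> dtranss"
      using good_en[OF good, of e W] L by (auto simp: dtranss_def)
    define k' where "k' = (\<lambda>b. if b \<in> post e then insert e W else k b)"
    note f = finish_good[OF good[unfolded L], folded k'_def L]
    have "x' = (ind (marked (insert e C) k' (L1 @ L2)), map (\<lambda>(e, W). Fire e W) (L1 @ L2))"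
      using finish n eW t f(3) ind_add[OF f(2)]
      by (simp add: L1_def L2_def take_map drop_map del: produces.simps)
    moreover have "st_step N y (Finish a n)
        (\<lambda>s. cnt (avail C L) s + postT N (map (\<lambda>(e, W). tr e) L ! n) s,
         take n (map (\<lambda>(e, W). tr e) L) @ drop (Suc n) (map (\<lambda>(e, W). tr e) L))"
      unfolding y using finish n eW by (intro st_step.finish) auto
    moreover have "(\<lambda>s. cnt (avail C L) s + postT N (map (\<lambda>(e, W). tr e) L ! n) s) =
        cnt (avail (insert e C) (L1 @ L2))"
      using f(4) n eW by (auto simp: postT_def)
    moreover have "take n (map (\<lambda>(e, W). tr e) L) @ drop (Suc n) (map (\<lambda>(e, W). tr e) L) =
        map (\<lambda>(e, W). tr e) (L1 @ L2)"
      by (simp add: L1_def L2_def take_map drop_map)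
    ultimately show ?thesis
      using f(1) finish(1) by (intro exI[of _ "insert e C"] exI[of _ k'] exI[of _ "L1 @ L2"]) (simp add: rel_def)
  qed (use na in simp)
qed

text \<open>By plainness every \<open>Fire\<close> is visible, so a silent step is a
  \<open>Learn\<close>, which leaves the represented state of \<open>N\<close> unchanged.\<close>

lemma rel_tau:
  assumes pl: "plain N" and rel: "rel C k L x y" and step: "st_step dnet x Tau x'"
  shows "\<exists>k'. rel C k' L x' y \<and> lag C k' L < lag C k L"
proof -
  have good: "good C k L"
    and x: "x = (ind (marked C k L), map (\<lambda>(e, W). Fire e W) L)"
    and y: "y = (cnt (avail C L), map (\<lambda>(e, W). tr e) L)"
    using rel by (auto simp: rel_def)
  from step[unfolded x] show ?thesis
  proof (cases rule: st_step.cases)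
    case (tau t M')
    have "t \<in> dtranss" using tau by simp
    then obtain b W z where t: "t = Learn b W z"
      using tau pl by (auto simp: dtranss_def plain_def en_def)
    have con: "consumes t \<subseteq> marked C k L"
      using tau by (simp add: fires_single ind_le_iff del: consumes.simps)
    note l = learn_good[OF good \<open>t \<in> dtranss\<close>[unfolded t] con[unfolded t]]
    have "M' = (\<lambda>p. ind (marked C k L) p - ind (consumes t) p + ind (produces t) p)"
      using tau by (simp add: fires_single del: consumes.simps produces.simps)
    then have "M' = ind (marked C (k(b := insert z W)) L)"
      using ind_add[OF l(5)] l(6) by (simp add: ind_diff t del: consumes.simps produces.simps)
    then show ?thesis
      using l(4) lag_learn[OF good \<open>t \<in> dtranss\<close>[unfolded t] con[unfolded t]] tau y
      by (intro exI[of _ "k(b := insert z W)"]) (auto simp: rel_def)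
  qed
qed

text \<open>A start in \<open>N\<close> is matched after the tokens concerned have caught up
  silently; a finish is matched at once.\<close>

lemma rel_backward:
  assumes pl: "plain N" and rel: "rel C k L x y" and step: "st_step N y \<alpha> y'"
  shows "\<exists>k' C' k'' L' x' x''. dtau\<^sup>*\<^sup>* x x' \<and> rel C k' L x' y \<and> st_step dnet x' \<alpha> x'' \<and> rel C' k'' L' x'' y'"
proof -
  have good: "good C k L"
    and x: "x = (ind (marked C k L), map (\<lambda>(e, W). Fire e W) L)"
    and y: "y = (cnt (avail C L), map (\<lambda>(e, W). tr e) L)"
    using rel by (auto simp: rel_def)
  have C: "cfg C" using good by (simp add: good_def)
  from step[unfolded y] show ?thesis
  proof (cases rule: st_step.cases)
    case (start t a)
    have "\<And>s. Fpt N s t \<le> cnt (avail C L) s"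
      using start by (simp add: enabled_single)
    \<comment> \<open>The marking of \<open>N\<close> only counts tokens; concrete ones must be
      selected to obtain an event.\<close>
    then obtain B where B: "B \<subseteq> avail C L" "\<And>s. cnt B s = Fpt N s t"
      using cnt_subset_exists[OF good_finite_avail[OF good], of "\<lambda>s. Fpt N s t"] by blast
    then obtain e where e: "tr e = t" "pre e = B"
      using pre_exists[OF finite_subset[OF B(1) good_finite_avail[OF good]]] by blast
    have en: "e \<in> en C"
      using e B start(3) subset_trans[OF B(1) avail_subset] by (simp add: en_def)
    have av: "pre e \<subseteq> avail C L"
      using e B by simp
    \<comment> \<open>The event is fired at \<open>C\<close> itself, which all its tokens can come
      to know.\<close>
    obtain k' where k': "good C k' L"
        "dtau\<^sup>*\<^sup>* (ind (marked C k L), map (\<lambda>(e, W). Fire e W) L) (ind (marked C k' L), map (\<lambda>(e, W). Fire e W) L)"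
        "\<And>b. b \<in> pre e \<Longrightarrow> k' b = C"
      using catch_up[OF good en av, of "map (\<lambda>(e, W). Fire e W) L"] by blast
    have t: "Fire e C \<in> dtranss"
      using C en by (auto simp: dtranss_def)
    let ?x' = "(ind (marked C k' L), map (\<lambda>(e, W). Fire e W) L)"
    let ?L = "L @ [(e, C)]"
    have "st_step dnet ?x' (Start a) (\<lambda>p. ind (marked C k' L) p - preT dnet (Fire e C) p, map (\<lambda>(e, W). Fire e W) L @ [Fire e C])"
      using t e start start_good(2)[OF k'(1) C en av k'(3)]
      by (intro st_step.start) (auto simp: enabled_single ind_le_iff simp del: consumes.simps)
    moreover have "(\<lambda>p. ind (marked C k' L) p - preT dnet (Fire e C) p) = ind (marked C k' ?L)"
      using t start_good(3)[OF k'(1) C en av k'(3)] by (simp add: ind_diff del: consumes.simps)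
    ultimately have "st_step dnet ?x' (Start a) (ind (marked C k' ?L), map (\<lambda>(e, W). Fire e W) ?L)"
      by simp
    moreover have "rel C k' ?L (ind (marked C k' ?L), map (\<lambda>(e, W). Fire e W) ?L) y'"
      using start_good(1)[OF k'(1) C en av k'(3)] start_good(4)[OF k'(1) C en av k'(3)] start e
      by (auto simp: rel_def preT_def)
    moreover have "rel C k' L ?x' y"
      using k' y by (simp add: rel_def)
    ultimately show ?thesis
      using k'(2) x start(1) by blast
  next
    case (finish n a)
    define L1 L2 where "L1 = take n L" and "L2 = drop (Suc n) L"
    obtain e W where eW: "L ! n = (e, W)" by fastforce
    have n: "n < length L" using finish by simp
    have L: "L = L1 @ (e, W) # L2"
      using id_take_nth_drop[OF n] eW by (simp add: L1_def L2_def)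
    have t: "Fire e W \<in> dtranss"
      using good_en[OF good, of e W] L by (auto simp: dtranss_def)
    define k' where "k' = (\<lambda>b. if b \<in> post e then insert e W else k b)"
    note f = finish_good[OF good[unfolded L], folded k'_def L]
    let ?x = "(ind (marked (insert e C) k' (L1 @ L2)), map (\<lambda>(e, W). Fire e W) (L1 @ L2))"
    have "st_step dnet x (Finish a n)
        (\<lambda>p. ind (marked C k L) p + postT dnet (map (\<lambda>(e, W). Fire e W) L ! n) p,
         take n (map (\<lambda>(e, W). Fire e W) L) @ drop (Suc n) (map (\<lambda>(e, W). Fire e W) L))"
      unfolding x using finish n eW by (intro st_step.finish) auto
    moreover have "(\<lambda>p. ind (marked C k L) p + postT dnet (map (\<lambda>(e, W). Fire e W) L ! n) p,
         take n (map (\<lambda>(e, W). Fire e W) L) @ drop (Suc n) (map (\<lambda>(e, W). Fire e W) L)) = ?x"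
      using n eW t f(3) ind_add[OF f(2)]
      by (simp add: L1_def L2_def take_map drop_map del: produces.simps)
    ultimately have "st_step dnet x (Finish a n) ?x" by simp
    moreover have "rel (insert e C) k' (L1 @ L2) ?x y'"
      using finish n eW f(1,4) by (auto simp: rel_def L1_def L2_def take_map drop_map postT_def)
    ultimately show ?thesis
      using rel finish(1) by blast
  next
    case (tau t M')
    then show ?thesis using pl by (auto simp: plain_def)
  qed
qed

text \<open>Each silent step lowers \<open>lag\<close>. Hence the divergence clause holds vacuously
  on this side.\<close>

lemma no_tau_path:
  assumes "plain N" "rel C k L (f 0) y" "\<And>j. st_step dnet (f j) Tau (f (Suc j))"
  shows False
  using assms(2,3)
proof (induction "lag C k L" arbitrary: k f rule: less_induct)
  case less
  obtain k' where k': "rel C k' L (f (Suc 0)) y" "lag C k' L < lag C k L"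
    using rel_tau[OF assms(1) less.prems(1)] less.prems(2) by blast
  show ?case
    using less.hyps[OF k'(2), of "\<lambda>j. f (Suc j)"] k'(1) less.prems(2) by blast
qed

theorem bSTb_dnet:
  assumes pl: "plain N"
  shows "bSTb_div_equiv dnet N"
proof -
  let ?R = "\<lambda>x y. \<exists>C k L. rel C k L x y"
  have no_tau: "\<not> st_step N y Tau y'" for y y'
  proof
    assume "st_step N y Tau y'"
    then show False
      using pl by cases (auto simp: plain_def)
  qed
  have "bbd_half (st_step dnet) (st_step N) ?R"
    unfolding bbd_half_def
  proof (intro conjI allI impI; elim conjE exE)
    fix x y \<alpha> x' C k L
    assume step: "st_step dnet x \<alpha> x'" and rel: "rel C k L x y"
    show "\<exists>y' y''. (\<lambda>a b. st_step N a Tau b)\<^sup>*\<^sup>* y y' \<and> opt_step (st_step N) y' \<alpha> y'' \<and> ?R x y' \<and> ?R x' y''"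
    proof (cases "\<alpha> = Tau")
      case True
      then obtain k' where "rel C k' L x' y"
        using rel_tau[OF pl rel] step by blast
      then show ?thesis
        using rel True by (intro exI[of _ y]) (auto simp: opt_step_def)
    next
      case False
      then obtain y' C' k' L' where "st_step N y \<alpha> y'" "rel C' k' L' x' y'"
        using rel_forward[OF rel step] by blast
      then show ?thesis
        using rel by (intro exI[of _ y] exI[of _ y']) (auto simp: opt_step_def)
    qed
  next
    fix x y f C k L
    assume "f 0 = x" "\<forall>j. st_step dnet (f j) Tau (f (Suc j)) \<and> ?R (f j) y" "rel C k L x y"
    then show "\<exists>g. g 0 = y \<and> (\<forall>l. st_step N (g l) Tau (g (Suc l))) \<and> (\<forall>k l. ?R (f k) (g l))"
      using no_tau_path[OF pl] by blast
  qed
  moreover have "bbd_half (st_step N) (st_step dnet) ?R\<inverse>\<inverse>"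
    unfolding bbd_half_def
  proof (intro conjI allI impI; elim conjE)
    fix y x \<alpha> y'
    assume step: "st_step N y \<alpha> y'" and "?R\<inverse>\<inverse> y x"
    then obtain C k L where "rel C k L x y" by auto
    from rel_backward[OF pl this step] obtain x' x'' where
      "dtau\<^sup>*\<^sup>* x x'" "?R x' y" "st_step dnet x' \<alpha> x''" "?R x'' y'" by blast
    then show "\<exists>x' x''. dtau\<^sup>*\<^sup>* x x' \<and> opt_step (st_step dnet) x' \<alpha> x'' \<and> ?R\<inverse>\<inverse> y x' \<and> ?R\<inverse>\<inverse> y' x''"
      by (intro exI[of _ x'] exI[of _ x'']) (auto simp: opt_step_def)
  next
    fix y x f
    assume "\<forall>k. st_step N (f k) Tau (f (Suc k)) \<and> ?R\<inverse>\<inverse> (f k) x"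
    then show "\<exists>g. g 0 = x \<and> (\<forall>l. dtau (g l) (g (Suc l))) \<and> (\<forall>k l. ?R\<inverse>\<inverse> (f k) (g l))"
      using no_tau by blast
  qed
  ultimately have "bbd_bisim (st_step dnet) (st_step N) ?R"
    by (simp add: bbd_bisim_def)
  moreover have "?R (M0 dnet, []) (M0 N, [])"
    using rel_init by (intro exI)
  ultimately show ?thesis
    unfolding bSTb_div_equiv_def by (intro exI[of _ ?R] conjI)
qed

end

subsection \<open>Relabelling\<close>

text \<open>The renaming of states need only be injective on a step-closed set \<open>ok\<close>;
  this accommodates junk values outside the carrier of a net.\<close>

lemma bbd_bisim_transfer:
  assumes fwd: "\<And>x \<alpha> z. ok x \<Longrightarrow> step1 x \<alpha> z \<Longrightarrow> ok z \<and> step1' (h x) \<alpha> (h z)"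
    and bwd: "\<And>x \<alpha> z'. ok x \<Longrightarrow> step1' (h x) \<alpha> z' \<Longrightarrow> \<exists>z. ok z \<and> step1 x \<alpha> z \<and> z' = h z"
    and inj: "inj_on h (Collect ok)"
    and bis: "bbd_bisim step1 step2 R"
  shows "bbd_bisim step1' step2 (\<lambda>x' y. \<exists>x. ok x \<and> x' = h x \<and> R x y)"
    (is "bbd_bisim _ _ ?R'")
proof -
  have h1: "bbd_half step1 step2 R" and h2: "bbd_half step2 step1 R\<inverse>\<inverse>"
    using bis by (auto simp: bbd_bisim_def)
  have heq: "h x = h y \<longleftrightarrow> x = y" if "ok x" "ok y" for x y
    using inj that by (auto simp: inj_on_def)
  have "bbd_half step1' step2 ?R'"
    unfolding bbd_half_def
  proof (intro conjI allI impI; elim conjE exE)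
    fix x' y \<alpha> z' x
    assume "step1' x' \<alpha> z'" and x: "ok x" "x' = h x" "R x y"
    then obtain z where z: "ok z" "step1 x \<alpha> z" "z' = h z"
      using bwd by blast
    obtain y' y'' where "(\<lambda>a b. step2 a Tau b)\<^sup>*\<^sup>* y y'" "opt_step step2 y' \<alpha> y''" "R x y'" "R z y''"
      using h1 x(3) z(2) unfolding bbd_half_def by blast
    then show "\<exists>y' y''. (\<lambda>a b. step2 a Tau b)\<^sup>*\<^sup>* y y' \<and> opt_step step2 y' \<alpha> y'' \<and> ?R' x' y' \<and> ?R' z' y''"
      using x z by blast
  next
    fix x' y f
    assume f: "\<forall>k. step1' (f k) Tau (f (Suc k)) \<and> ?R' (f k) y"
    then obtain e where e: "\<And>k. ok (e k)" "\<And>k. f k = h (e k)" "\<And>k. R (e k) y"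
      by metis
    \<comment> \<open>The step pulled back by \<open>bwd\<close> ends in some preimage; injectivity
      identifies it with the chosen one.\<close>
    have "step1 (e k) Tau (e (Suc k))" for k
    proof -
      have "step1' (h (e k)) Tau (h (e (Suc k)))"
        using f e(2) by metis
      then obtain z where "ok z" "step1 (e k) Tau z" "h (e (Suc k)) = h z"
        using bwd e(1) by blast
      then show ?thesis
        using heq e(1) by metis
    qed
    then obtain g where "g 0 = y" "\<forall>l. step2 (g l) Tau (g (Suc l))" "\<forall>k l. R (e k) (g l)"
      using h1 e(3) unfolding bbd_half_def by blast
    then show "\<exists>g. g 0 = y \<and> (\<forall>l. step2 (g l) Tau (g (Suc l))) \<and> (\<forall>k l. ?R' (f k) (g l))"
      using e by blast
  qed
  moreover have "bbd_half step2 step1' ?R'\<inverse>\<inverse>"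
    unfolding bbd_half_def
  proof (intro conjI allI impI; unfold conversep_iff; elim conjE exE)
    fix y x' \<alpha> y' x
    assume step: "step2 y \<alpha> y'" and x: "ok x" "x' = h x" "R x y"
    then obtain z w where zw: "(\<lambda>a b. step1 a Tau b)\<^sup>*\<^sup>* x z" "opt_step step1 z \<alpha> w" "R z y" "R w y'"
      using h2 unfolding bbd_half_def by blast
    from zw(1) have z: "ok z \<and> (\<lambda>a b. step1' a Tau b)\<^sup>*\<^sup>* (h x) (h z)"
    proof induction
      case base
      then show ?case using x by simp
    next
      case (step u v)
      then show ?case
        using fwd by (meson rtranclp.rtrancl_into_rtrancl)
    qed
    then have "ok w \<and> opt_step step1' (h z) \<alpha> (h w)"
      using zw(2) fwd unfolding opt_step_def by blast
    then show "\<exists>z' w'. (\<lambda>a b. step1' a Tau b)\<^sup>*\<^sup>* x' z' \<and> opt_step step1' z' \<alpha> w' \<and> ?R' z' y \<and> ?R' w' y'"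
      using x z zw by blast
  next
    fix y x' f
    assume f0: "f 0 = y" and f: "\<forall>k. step2 (f k) Tau (f (Suc k)) \<and> ?R' x' (f k)"
    then obtain x where x: "ok x" "x' = h x" by blast
    \<comment> \<open>A priori the preimage of \<open>x'\<close> depends on \<open>k\<close>;
      injectivity makes it the same throughout.\<close>
    then have "R x (f k)" for k
      using f heq by metis
    then obtain g where g: "g 0 = x" "\<forall>l. step1 (g l) Tau (g (Suc l))" "\<forall>k l. R (g l) (f k)"
      using h2 f f0 unfolding bbd_half_def conversep_iff by blast
    have "ok (g l)" for l
    proof (induction l)
      case 0
      then show ?case using g(1) x(1) by simp
    next
      case (Suc l)
      then show ?case using fwd g(2) by blast
    qed
    then show "\<exists>g. g 0 = x' \<and> (\<forall>l. step1' (g l) Tau (g (Suc l))) \<and> (\<forall>k l. ?R' (g l) (f k))"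
      using g x fwd by (intro exI[of _ "\<lambda>l. h (g l)"]) blast
  qed
  ultimately show ?thesis
    by (simp add: bbd_bisim_def)
qed

locale relabelling =
  fixes D :: "('p, 'q, 'a) pnet" and f :: "'p \<Rightarrow> 'p2" and g :: "'q \<Rightarrow> 'q2"
  assumes wf: "wf_net D" and injf: "inj_on f (places D)" and injg: "inj_on g (transs D)"
begin

abbreviation "finv \<equiv> inv_into (places D) f"
abbreviation "ginv \<equiv> inv_into (transs D) g"

definition push :: "('p \<Rightarrow> nat) \<Rightarrow> 'p2 \<Rightarrow> nat" where
  "push m = (\<lambda>p. if p \<in> f ` places D then m (finv p) else 0)"

definition relabelled :: "('p2, 'q2, 'a) pnet" where
  "relabelled = \<lparr> places = f ` places D, transs = g ` transs D,
     Fpt = (\<lambda>p t. if t \<in> g ` transs D then push (\<lambda>q. Fpt D q (ginv t)) p else 0),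
     Ftp = (\<lambda>t p. if t \<in> g ` transs D then push (Ftp D (ginv t)) p else 0),
     M0 = push (M0 D), lab = (\<lambda>t. lab D (ginv t)) \<rparr>"

lemma relabelled_simps [simp]:
  "places relabelled = f ` places D" "transs relabelled = g ` transs D"
  "M0 relabelled = push (M0 D)"
  "t \<in> transs D \<Longrightarrow> lab relabelled (g t) = lab D t"
  "t \<in> transs D \<Longrightarrow> Fpt relabelled p (g t) = push (\<lambda>q. Fpt D q t) p"
  "t \<in> transs D \<Longrightarrow> Ftp relabelled (g t) p = push (Ftp D t) p"
  using injg by (auto simp: relabelled_def)

lemma push_f [simp]: "p \<in> places D \<Longrightarrow> push m (f p) = m p"
  using injf by (simp add: push_def)

lemma push_add: "push (\<lambda>p. a p + b p) p = push a p + push b p"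
  and push_diff: "push (\<lambda>p. a p - b p) p = push a p - push b p"
  by (auto simp: push_def)

text \<open>\<open>push\<close> forgets values outside the carrier, so \<open>a\<close> must vanish
  there.\<close>

lemma push_le_iff:
  assumes "\<And>p. p \<notin> places D \<Longrightarrow> a p = 0"
  shows "(\<forall>p. push a p \<le> push b p) \<longleftrightarrow> (\<forall>p. a p \<le> b p)"
proof
  assume le: "\<forall>p. push a p \<le> push b p"
  show "\<forall>p. a p \<le> b p"
  proof
    fix p show "a p \<le> b p"
      using le[rule_format, of "f p"] assms[of p] by (cases "p \<in> places D") auto
  qed
qed (auto simp: push_def)

lemma F_outside: "p \<notin> places D \<Longrightarrow> Fpt D p t = 0" "p \<notin> places D \<Longrightarrow> Ftp D t p = 0"
  "p \<notin> places D \<Longrightarrow> M0 D p = 0"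
  using wf unfolding wf_net_def by blast+

lemma wf_relabelled: "wf_net relabelled"
  unfolding wf_net_def relabelled_def by (auto simp: push_def split: if_splits)

lemma preG_relabelled:
  assumes "set_mset G \<subseteq> transs D"
  shows "preG relabelled (image_mset g G) p = push (preG D G) p"
    and "postG relabelled (image_mset g G) p = push (postG D G) p"
  using assms by (induction G) (auto simp: preG_def postG_def push_def)

lemma fires_relabelled:
  assumes "set_mset G \<subseteq> transs D"
  shows "fires relabelled (push m) (image_mset g G) m' \<longleftrightarrow> (\<exists>m1. fires D m G m1 \<and> m' = push m1)"
proof -
  have "preG D G p = 0" if "p \<notin> places D" for p
    using F_outside(1)[OF that] by (simp add: preG_def)
  then have "(\<forall>p. push (preG D G) p \<le> push m p) \<longleftrightarrow> (\<forall>p. preG D G p \<le> m p)"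
    using push_le_iff by blast
  moreover have "push (\<lambda>p. m p - preG D G p + postG D G p) =
      (\<lambda>p. push m p - push (preG D G) p + push (postG D G) p)"
    by (auto simp: push_def)
  ultimately show ?thesis
    using assms by (auto simp: fires_def preG_relabelled)
qed

lemma mset_relabelled:
  assumes "set_mset G' \<subseteq> g ` transs D"
  obtains G where "set_mset G \<subseteq> transs D" "G' = image_mset g G"
proof (rule that)
  show "set_mset (image_mset ginv G') \<subseteq> transs D"
    using assms by (auto intro: inv_into_into)
  show "G' = image_mset g (image_mset ginv G')"
    using assms by (auto simp: multiset.map_comp f_inv_into_f subset_iff intro!: sym[OF multiset.map_ident_strong])
qed

lemma reachable_relabelled: "reachable relabelled m' \<Longrightarrow> \<exists>m. reachable D m \<and> m' = push m"
proof (induction rule: reachable.induct)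
  case init
  then show ?case using reachable.init by auto
next
  case (step m' G' m1')
  then obtain m where m: "reachable D m" "m' = push m" by blast
  obtain G where G: "set_mset G \<subseteq> transs D" "G' = image_mset g G"
    using step.hyps(2) mset_relabelled[of G'] by (auto simp: fires_def)
  then show ?case
    using step.hyps(2) m fires_relabelled[OF G(1)] reachable.step[OF m(1)] by blast
qed

lemma concurrent_relabelled:
  assumes "t \<in> transs D" "u \<in> transs D" "concurrent relabelled (g t) (g u)"
  shows "concurrent D t u"
proof -
  let ?G = "{#t#} + {#u#}"
  have "image_mset g ?G = {#g t#} + {#g u#}"
    by simp
  then obtain m' m1' where m': "reachable relabelled m'" "fires relabelled m' (image_mset g ?G) m1'"
    using assms(3) unfolding concurrent_def enabled_def by metis
  obtain m where m: "reachable D m" "m' = push m"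
    using reachable_relabelled[OF m'(1)] by blast
  moreover have "set_mset ?G \<subseteq> transs D"
    using assms(1,2) by simp
  ultimately show ?thesis
    using m'(2) fires_relabelled unfolding concurrent_def enabled_def by blast
qed

text \<open>Locations need not be names of nodes of the net, so each one is renamed to a
transition residing there.\<close>
lemma distributed_relabelled:
  assumes "distributed D"
  shows "distributed relabelled"
proof -
  obtain l :: "'p + 'q \<Rightarrow> 'p + 'q" where
    l: "\<And>s t. s \<in> places D \<Longrightarrow> t \<in> transs D \<Longrightarrow> preT D t s \<noteq> 0 \<Longrightarrow> l (Inr t) = l (Inl s)"
      "\<And>t u. t \<in> transs D \<Longrightarrow> u \<in> transs D \<Longrightarrow> concurrent D t u \<Longrightarrow> l (Inr t) \<noteq> l (Inr u)"
    using assms unfolding distributed_def by blast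
  \<comment> \<open>For a location without transitions the choice is arbitrary; only locations of
    transitions and of their preplaces are constrained.\<close>
  define rep where "rep v = g (SOME t. t \<in> transs D \<and> l (Inr t) = v)" for v
  have rep: "rep (l (Inr t)) = rep (l (Inr u)) \<longleftrightarrow> l (Inr t) = l (Inr u)"
    if "t \<in> transs D" "u \<in> transs D" for t u
  proof
    have ex: "\<exists>s. s \<in> transs D \<and> l (Inr s) = l (Inr t)" "\<exists>s. s \<in> transs D \<and> l (Inr s) = l (Inr u)"
      using that by blast+
    assume "rep (l (Inr t)) = rep (l (Inr u))"
    then have "(SOME s. s \<in> transs D \<and> l (Inr s) = l (Inr t)) = (SOME s. s \<in> transs D \<and> l (Inr s) = l (Inr u))"
      using someI_ex[OF ex(1)] someI_ex[OF ex(2)] injg unfolding rep_def inj_on_def by blast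
    then show "l (Inr t) = l (Inr u)"
      using someI_ex[OF ex(1)] someI_ex[OF ex(2)] by metis
  qed simp
  let ?l = "case_sum (\<lambda>p. Inr (rep (l (Inl (finv p))))) (\<lambda>t. Inr (rep (l (Inr (ginv t)))))"
  show ?thesis
    unfolding distributed_def
  proof (intro exI[of _ ?l] conjI ballI impI)
    fix s t assume "s \<in> places relabelled" "t \<in> transs relabelled" "preT relabelled t s \<noteq> 0"
    then show "?l (Inr t) = ?l (Inl s)"
      using l(1) injf injg by (auto simp: preT_def)
  next
    fix t u assume "t \<in> transs relabelled" "u \<in> transs relabelled" "concurrent relabelled t u"
    then show "?l (Inr t) \<noteq> ?l (Inr u)"
      using l(2) rep injg concurrent_relabelled by auto
  qed
qed

text \<open>The states on which \<open>rename\<close> loses no information.\<close>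

definition supported :: "('p \<Rightarrow> nat) \<times> 'q list \<Rightarrow> bool" where
  "supported x \<longleftrightarrow> (\<forall>p. p \<notin> places D \<longrightarrow> fst x p = 0) \<and> set (snd x) \<subseteq> transs D"

definition rename :: "('p \<Rightarrow> nat) \<times> 'q list \<Rightarrow> ('p2 \<Rightarrow> nat) \<times> 'q2 list" where
  "rename x = (push (fst x), map g (snd x))"

lemma inj_on_rename: "inj_on rename (Collect supported)"
proof (rule inj_onI)
  fix x y assume xy: "x \<in> Collect supported" "y \<in> Collect supported" "rename x = rename y"
  have "fst x p = fst y p" for p
    using xy push_f[of p "fst x"] push_f[of p "fst y"] by (cases "p \<in> places D") (auto simp: supported_def rename_def)
  moreover have "snd x = snd y"
    using xy injg by (intro inj_on_map_eq_map[THEN iffD1, of g])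
      (auto simp: supported_def rename_def intro: inj_on_subset)
  ultimately show "x = y"
    by (auto simp: prod_eq_iff)
qed

lemma fires_single_relabelled:
  assumes "t \<in> transs D"
  shows "fires relabelled (push m) {#g t#} m' \<longleftrightarrow> (\<exists>m1. fires D m {#t#} m1 \<and> m' = push m1)"
  using fires_relabelled[of "{#t#}"] assms by simp

lemma enabled_single_relabelled:
  "t \<in> transs D \<Longrightarrow> enabled relabelled (push m) {#g t#} \<longleftrightarrow> enabled D m {#t#}"
  unfolding enabled_def using fires_single_relabelled by blast

lemma st_step_relabelled:
  assumes "supported x" "st_step D x \<alpha> z"
  shows "supported z \<and> st_step relabelled (rename x) \<alpha> (rename z)"
  using assms(2)
proof (cases rule: st_step.cases)
  case (start t a M U)
  have "(\<lambda>p. push M p - preT relabelled (g t) p) = push (\<lambda>p. M p - preT D t p)"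
    using start(4) by (auto simp: preT_def push_diff)
  then show ?thesis
    using start assms(1) st_step.start[of "g t" relabelled a "push M" "map g U"]
    by (auto simp: supported_def rename_def enabled_single_relabelled)
next
  case (finish n U a M)
  have n: "U ! n \<in> transs D"
    using finish assms(1) by (auto simp: supported_def)
  have "(\<lambda>p. push M p + postT relabelled (map g U ! n) p) = push (\<lambda>p. M p + postT D (U ! n) p)"
    using finish n by (auto simp: postT_def push_add)
  moreover have "set (take n U @ drop (Suc n) U) \<subseteq> transs D"
    using finish assms(1) set_take_subset[of n U] set_drop_subset[of "Suc n" U] by (auto simp: supported_def)
  ultimately show ?thesis
    using finish n assms(1) F_outside st_step.finish[of n "map g U" relabelled a "push M"]
    by (auto simp: supported_def rename_def postT_def take_map drop_map)
next
  case (tau t M M' U)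
  then have "fires relabelled (push M) {#g t#} (push M')"
    using fires_single_relabelled by blast
  then show ?thesis
    using tau assms(1) F_outside st_step.tau[of "g t" relabelled "push M" "push M'" "map g U"]
    by (auto simp: supported_def rename_def fires_single)
qed

lemma st_step_relabelledD:
  assumes x: "supported x" and step: "st_step relabelled (rename x) \<alpha> z'"
  shows "\<exists>z. supported z \<and> st_step D x \<alpha> z \<and> z' = rename z"
proof -
  obtain M U where MU: "x = (M, U)" by fastforce
  have "\<exists>z. st_step D x \<alpha> z \<and> z' = rename z"
    using step[unfolded MU rename_def fst_conv snd_conv]
  proof (cases rule: st_step.cases)
    case (start t' a)
    then obtain t where t: "t \<in> transs D" "t' = g t" by auto
    have "(\<lambda>p. push M p - preT relabelled (g t) p) = push (\<lambda>p. M p - preT D t p)"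
      using t by (auto simp: preT_def push_diff)
    then show ?thesis
      using start t st_step.start[of t D a M U] MU
      by (auto simp: rename_def enabled_single_relabelled intro!: exI)
  next
    case (finish n a)
    have n: "n < length U" "U ! n \<in> transs D"
      using finish x MU by (auto simp: supported_def)
    have "(\<lambda>p. push M p + postT relabelled (map g U ! n) p) = push (\<lambda>p. M p + postT D (U ! n) p)"
      using n by (auto simp: postT_def push_add)
    then show ?thesis
      using finish n st_step.finish[of n U D a M] MU
      by (auto simp: rename_def take_map drop_map intro!: exI)
  next
    case (tau t' M')
    then obtain t where t: "t \<in> transs D" "t' = g t" by auto
    then obtain M1 where "fires D M {#t#} M1" "M' = push M1"
      using tau fires_single_relabelled by auto
    then show ?thesis
      using tau t st_step.tau[of t D M M1 U] MU by (auto simp: rename_def intro!: exI)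
  qed
  then show ?thesis
    using st_step_relabelled[OF x] by blast
qed

lemma bSTb_relabelled:
  assumes "bSTb_div_equiv D N"
  shows "bSTb_div_equiv relabelled N"
proof -
  obtain R where R: "R (M0 D, []) (M0 N, [])" "bbd_bisim (st_step D) (st_step N) R"
    using assms unfolding bSTb_div_equiv_def by blast
  have "supported (M0 D, [])" "(M0 relabelled, []) = rename (M0 D, [])"
    by (auto simp: supported_def rename_def F_outside)
  moreover have "bbd_bisim (st_step relabelled) (st_step N)
      (\<lambda>x' y. \<exists>x. supported x \<and> x' = rename x \<and> R x y)"
    by (rule bbd_bisim_transfer[of supported "st_step D"])
      (use st_step_relabelled st_step_relabelledD inj_on_rename R(2) in blast)+
  ultimately show ?thesis
    unfolding bSTb_div_equiv_def using R(1)
    by (intro exI[of _ "\<lambda>x' y. \<exists>x. supported x \<and> x' = rename x \<and> R x y"]) auto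
qed

end

text \<open>The number tags put a copy of the naturals into the universe for any \<open>'s\<close>
  and \<open>'t\<close>, so every countable carrier embeds.\<close>

lemma inj_nat_univ: "inj (\<lambda>n. [{Inr (Inr n)}] :: ('s, 't) univ)"
  by (auto simp: inj_def)

lemma countable_inj_univ:
  assumes "countable A"
  obtains f :: "'b \<Rightarrow> ('s, 't) univ" where "inj_on f A"
  using comp_inj_on[OF inj_on_to_nat_on[OF assms] inj_on_subset[OF inj_nat_univ subset_UNIV]] by blast

theorem theorem7p12:
  fixes N :: "('s, 't, 'a) pnet"
  assumes "wf_net N"
    and "finitary N"
    and "plain N"
    and "structural_conflict_net N"
    and "\<not> fully_reachable_pure_M N"
  shows "\<exists>D :: (('s, 't) univ, ('s, 't) univ, 'a) pnet.
           wf_net D \<and> distributed D \<and> bSTb_div_equiv D N"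
proof -
  interpret unfolding_net N
    using assms by unfold_locales
  obtain f :: "('s, 't) dplace \<Rightarrow> ('s, 't) univ" where f: "inj_on f dplaces"
    using countable_inj_univ[OF countable_dplaces] .
  obtain g :: "('s, 't) dtrans \<Rightarrow> ('s, 't) univ" where g: "inj_on g dtranss"
    using countable_inj_univ[OF countable_dtranss] .
  interpret relabelling dnet f g
    using wf_dnet f g by unfold_locales auto
  show ?thesis
    using wf_relabelled distributed_relabelled[OF distributed_dnet] bSTb_relabelled[OF bSTb_dnet[OF assms(3)]]
    by blast
qed

end
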